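(* For every integer $d\geq1$, \[ \alpha_{\mathbb{C}}(d) \geq \frac8{3\pi} - \frac4d \qquad\text{and}\qquad \alpha_{\mathbb{R}}(d) \geq \frac8{3\pi} - 3 \sqrt{\frac1{d}}- \frac4d. \]
   Context: Let $G_{\mathbb{R}}\in\mathbb{R}^{d\times d}$ have i.i.d. real $\mathcal{N}(0,d^{-1})$ entries and $G_{\mathbb{C}}\in\mathbb{C}^{d\times d}$ i.i.d. circularly symmetric complex Gaussian entries with $\mathbb{E}|z|^2=d^{-1}$. Define $\alpha_{\mathbb{R}}(d)=\mathbb{E}\left[\frac1d\sum_{j=1}^d\sigma_j(G_{\mathbb{R}})\right]$ and $\alpha_{\mathbb{C}}(d)=\mathbb{E}\left[\frac1d\sum_{j=1}^d\sigma_j(G_{\mathbb{C}})\right]$, where $\sigma_j$ is the $j$-th singular value. *)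

theory Defs
  imports "HOL-Probability.Probability" "Jordan_Normal_Form.Schur_Decomposition"
    "HOL-Computational_Algebra.Fundamental_Theorem_Algebra"
begin

text \<open>Singular values of a complex square matrix A: the square roots of the eigenvalues of
  A^* A, counted with algebraic multiplicity (roots of the characteristic polynomial).
  These eigenvalues are nonnegative reals.  We record their sum.\<close>
definition singular_values :: "complex mat \<Rightarrow> real multiset" where
  "singular_values A = image_mset (\<lambda>e. sqrt (Re e)) (proots (char_poly (mat_adjoint A * A)))"

definition sum_singular_values :: "complex mat \<Rightarrow> real" where
  "sum_singular_values A = sum_mset (singular_values A)"

definition entries :: "nat \<Rightarrow> (nat \<times> nat) set" where
  "entries d = {..<d} \<times> {..<d}"

definition real_gauss :: "nat \<Rightarrow> real measure" where
  "real_gauss d = density lborel (\<lambda>x. ennreal (normal_density 0 (sqrt (1 / real d)) x))"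

text \<open>Circularly symmetric complex Gaussian with E|z|^2 = 1/d:
  density (d/pi) exp(-d |z|^2) w.r.t. Lebesgue measure on C = R^2.\<close>
definition complex_gauss :: "nat \<Rightarrow> complex measure" where
  "complex_gauss d = density lborel (\<lambda>z. ennreal (real d / pi * exp (- real d * (cmod z)\<^sup>2)))"

definition real_ginibre :: "nat \<Rightarrow> (nat \<times> nat \<Rightarrow> real) measure" where
  "real_ginibre d = PiM (entries d) (\<lambda>_. real_gauss d)"

definition complex_ginibre :: "nat \<Rightarrow> (nat \<times> nat \<Rightarrow> complex) measure" where
  "complex_ginibre d = PiM (entries d) (\<lambda>_. complex_gauss d)"

definition real_matrix_of :: "nat \<Rightarrow> (nat \<times> nat \<Rightarrow> real) \<Rightarrow> complex mat" where
  "real_matrix_of d G = mat d d (\<lambda>(i,j). complex_of_real (G (i,j)))"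

definition complex_matrix_of :: "nat \<Rightarrow> (nat \<times> nat \<Rightarrow> complex) \<Rightarrow> complex mat" where
  "complex_matrix_of d G = mat d d (\<lambda>(i,j). G (i,j))"

definition alpha_R :: "nat \<Rightarrow> real" where
  "alpha_R d = (\<integral>G. sum_singular_values (real_matrix_of d G) / real d \<partial>real_ginibre d)"

definition alpha_C :: "nat \<Rightarrow> real" where
  "alpha_C d = (\<integral>G. sum_singular_values (complex_matrix_of d G) / real d \<partial>complex_ginibre d)"

end

theory Submission
  imports Defs "HOL-Real_Asymp.Real_Asymp"
begin

text \<open>
  Let \<open>R = (G\<^sup>* G + t)\<^sup>-\<^sup>1\<close> and let \<open>M(t)\<close> be the expectation of \<open>m = tr R / d\<close>. Gaussian integration by
  parts applied to \<open>tr (G R G\<^sup>*) = d - t tr R\<close> yields the loop equation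
  \<open>1 - t M(t) = t E[m\<^sup>2] - \<delta>\<close>, where \<open>\<delta> = 0\<close> in the complex case and \<open>0 \<le> \<delta> \<le> 1 / (4 t d)\<close> in the real
  case. As \<open>E[m\<^sup>2] \<ge> M(t)\<^sup>2\<close>, this is a quadratic inequality which bounds \<open>M(t)\<close> from above by the
  Stieltjes transform of the Marchenko--Pastur law, exactly in the complex case and up to an
  explicit error in the real case. Integrating \<open>\<surd>x = (2 / \<pi>) \<integral> x / (x + u\<^sup>2) du\<close> over \<open>u > 0\<close>, with
  \<open>t = u\<^sup>2\<close>, turns this into a lower bound for the expected mean singular value: the
  Marchenko--Pastur term gives \<open>8 / (3 \<pi>)\<close>, and the error is at most \<open>1 / \<surd>d\<close> (real) or \<open>0\<close> (complex).
\<close>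

section \<open>The resolvent of a Gram matrix\<close>

text \<open>The signs fit together because x / (x + t) = 1 - t / (x + t): singular values are
  bounded from below by bounding M(t) from above, and on that side the fluctuation of m may be
  discarded through E[m^2] >= M(t)^2. The entries are unbounded, but the matrix functions that enter
  integration by parts are bounded in terms of t alone. With A^H the adjoint of A, this follows from
  R = (R A^H)(R A^H)^H + t R R^H and its analogue for A R A^H, read off on the diagonal. Derivatives
  of R are taken from exact finite differences under a change of one entry. Both fields are handled
  at once: an entry is a Gaussian vector in a Euclidean space, embedded linearly and isometrically
  into the complex numbers. In the quadratic inequality \<delta> becomes \<epsilon> / 4 with
  \<epsilon> = 1 / d or 0. Near u = 0 this can move the root by sqrt \<epsilon> / 2, and the
  envelope sqrt \<epsilon> / (1 + u^2) covers the displacement for all u. Its integral is sqrt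
  \<epsilon> times pi / 2, which the factor 2 / pi turns into exactly sqrt \<epsilon>.\<close>

lemma mat_adjoint_carrier [simp, intro]:
  "A \<in> carrier_mat m n \<Longrightarrow> mat_adjoint A \<in> carrier_mat n m"
  by (auto simp: mat_adjoint_def)

lemma mat_adjoint_dim [simp]:
  "dim_row (mat_adjoint A) = dim_col A" "dim_col (mat_adjoint A) = dim_row A"
  by (auto simp: mat_adjoint_def)

lemma mat_adjoint_index [simp]:
  "i < dim_col A \<Longrightarrow> j < dim_row A \<Longrightarrow> mat_adjoint A $$ (i, j) = conjugate (A $$ (j, i))"
  by (simp add: mat_adjoint_def mat_of_rows_index)

lemma mult_carrier_square [simp, intro]:
  "A \<in> carrier_mat n n \<Longrightarrow> B \<in> carrier_mat n n \<Longrightarrow> A * B \<in> carrier_mat n n"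
  by (rule mult_carrier_mat)

lemma mat_mult_index:
  assumes "A \<in> carrier_mat m n" "B \<in> carrier_mat n k" "i < m" "j < k"
  shows "(A * B) $$ (i, j) = (\<Sum>l<n. A $$ (i, l) * B $$ (l, j))"
  using assms by (auto simp: scalar_prod_def atLeast0LessThan intro!: sum.cong)

lemma mat_adjoint_mult:
  fixes A :: "complex mat"
  assumes "A \<in> carrier_mat m n" "B \<in> carrier_mat n k"
  shows "mat_adjoint (A * B) = mat_adjoint B * mat_adjoint A"
proof (rule eq_matI)
  fix i j assume ij: "i < dim_row (mat_adjoint B * mat_adjoint A)"
    "j < dim_col (mat_adjoint B * mat_adjoint A)"
  have "(mat_adjoint B * mat_adjoint A) $$ (i, j)
      = (\<Sum>l<n. mat_adjoint B $$ (i, l) * mat_adjoint A $$ (l, j))"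
    using ij assms by (intro mat_mult_index[of _ k n _ m]) auto
  moreover have "(A * B) $$ (j, i) = (\<Sum>l<n. A $$ (j, l) * B $$ (l, i))"
    using ij assms by (intro mat_mult_index[of _ m n _ k]) auto
  ultimately show "mat_adjoint (A * B) $$ (i, j) = (mat_adjoint B * mat_adjoint A) $$ (i, j)"
    using ij assms by (auto simp: cnj_sum mult.commute intro!: sum.cong)
qed (use assms in auto)

lemma mat_adjoint_adjoint [simp]: "mat_adjoint (mat_adjoint (A :: complex mat)) = A"
  by (rule eq_matI) auto

text \<open>Pairing the eigenvalue equation with v gives e |v|^2 = |A v|^2, so e is a quotient of
  nonnegative reals.\<close>

lemma gram_eigenvalue_nonneg:
  fixes A :: "complex mat"
  assumes A: "A \<in> carrier_mat n n" and v: "v \<in> carrier_vec n" "v \<noteq> 0\<^sub>v n"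
    and e: "(mat_adjoint A * A) *\<^sub>v v = e \<cdot>\<^sub>v v"
  shows "e \<in> \<real>" "Re e \<ge> 0"
proof -
  define w where "w = A *\<^sub>v v"
  have w: "w \<in> carrier_vec n" using A v by (auto simp: w_def)
  have w_index: "w $ k = (\<Sum>i<n. A $$ (k, i) * v $ i)" if "k < n" for k
    using that A v by (auto simp: w_def scalar_prod_def atLeast0LessThan intro!: sum.cong)
  have "mat_adjoint A *\<^sub>v w = e \<cdot>\<^sub>v v"
    using e A v by (simp add: w_def assoc_mult_mat_vec[symmetric, of _ n n _ n])
  then have ev: "(\<Sum>k<n. cnj (A $$ (k, i)) * w $ k) = e * v $ i" if "i < n" for i
  proof -
    have "(mat_adjoint A *\<^sub>v w) $ i = (\<Sum>k<n. cnj (A $$ (k, i)) * w $ k)"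
      using that A w by (auto simp: scalar_prod_def atLeast0LessThan intro!: sum.cong)
    then show ?thesis using \<open>mat_adjoint A *\<^sub>v w = e \<cdot>\<^sub>v v\<close> that v by simp
  qed
  define N where "N = (\<Sum>i<n. (cmod (v $ i))\<^sup>2)"
  define K where "K = (\<Sum>i<n. (cmod (w $ i))\<^sup>2)"
  have "e * of_real N = (\<Sum>i<n. cnj (v $ i) * (e * v $ i))"
    by (simp add: N_def sum_distrib_left complex_norm_square mult_ac del: of_real_power)
  also have "\<dots> = (\<Sum>i<n. cnj (v $ i) * (\<Sum>k<n. cnj (A $$ (k, i)) * w $ k))"
    by (intro sum.cong) (auto simp: ev)
  also have "\<dots> = (\<Sum>k<n. \<Sum>i<n. cnj (v $ i) * cnj (A $$ (k, i)) * w $ k)"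
    unfolding sum_distrib_left by (subst sum.swap) (simp add: mult.assoc)
  also have "\<dots> = (\<Sum>k<n. cnj (w $ k) * w $ k)"
  proof (intro sum.cong refl)
    fix k assume "k \<in> {..<n}"
    then have "cnj (w $ k) = (\<Sum>i<n. cnj (v $ i) * cnj (A $$ (k, i)))"
      by (simp add: w_index cnj_sum mult.commute)
    then show "(\<Sum>i<n. cnj (v $ i) * cnj (A $$ (k, i)) * w $ k) = cnj (w $ k) * w $ k"
      by (simp add: sum_distrib_right)
  qed
  also have "\<dots> = of_real K"
    by (simp add: K_def complex_norm_square mult_ac del: of_real_power)
  finally have eq: "e * of_real N = of_real K" .
  obtain i where "i < n" "v $ i \<noteq> 0" using v by (metis eq_vecI carrier_vecD index_zero_vec)
  then have "N > 0" unfolding N_def by (intro sum_pos2[of _ i]) auto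
  then have "e = of_real (K / N)" using eq by (simp add: field_simps)
  moreover have "K \<ge> 0" by (simp add: K_def sum_nonneg)
  ultimately show "e \<in> \<real>" "Re e \<ge> 0" using \<open>N > 0\<close> by auto
qed

definition shifted_gram :: "real \<Rightarrow> complex mat \<Rightarrow> complex mat" where
  "shifted_gram t A = mat_adjoint A * A + of_real t \<cdot>\<^sub>m 1\<^sub>m (dim_col A)"

text \<open>Adjugate over determinant, because the entries are then explicit rational functions of
  t, the matrix entries and their conjugates, hence measurable. For t > 0 the determinant does not
  vanish and this is the inverse.\<close>

definition resolvent :: "real \<Rightarrow> complex mat \<Rightarrow> complex mat" where
  "resolvent t A = inverse (Determinant.det (shifted_gram t A)) \<cdot>\<^sub>m adj_mat (shifted_gram t A)"

lemma shifted_gram_carrier [simp, intro]: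
  "A \<in> carrier_mat n n \<Longrightarrow> shifted_gram t A \<in> carrier_mat n n"
  by (auto simp: shifted_gram_def)

lemma resolvent_carrier [simp, intro]:
  "A \<in> carrier_mat n n \<Longrightarrow> resolvent t A \<in> carrier_mat n n"
  using adj_mat(1)[OF shifted_gram_carrier] by (auto simp: resolvent_def)

lemma resolvent_dim [simp]:
  "dim_row (resolvent t A) = dim_col A" "dim_col (resolvent t A) = dim_col A"
  by (auto simp: resolvent_def adj_mat_def shifted_gram_def)

text \<open>A kernel vector would be an eigenvector of A^H A for the negative eigenvalue -t.\<close>

lemma det_shifted_gram_nonzero:
  assumes A: "A \<in> carrier_mat n n" and t: "t > 0"
  shows "Determinant.det (shifted_gram t A) \<noteq> 0"
proof
  assume "Determinant.det (shifted_gram t A) = 0"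
  then obtain v where v: "v \<in> carrier_vec n" "v \<noteq> 0\<^sub>v n" "shifted_gram t A *\<^sub>v v = 0\<^sub>v n"
    using det_0_iff_vec_prod_zero[OF shifted_gram_carrier[OF A]] by auto
  have one: "(complex_of_real t \<cdot>\<^sub>m 1\<^sub>m n) *\<^sub>v v = of_real t \<cdot>\<^sub>v v"
    using v by (intro eq_vecI) (auto simp: row_smult)
  have "(mat_adjoint A * A) *\<^sub>v v + of_real t \<cdot>\<^sub>v v = 0\<^sub>v n"
    using v A unfolding shifted_gram_def
    by (subst (asm) add_mult_distrib_mat_vec[of _ n n]) (auto simp: one)
  then have "(mat_adjoint A * A) *\<^sub>v v = (- of_real t) \<cdot>\<^sub>v v"
    using v A by (auto simp: vec_eq_iff eq_neg_iff_add_eq_0)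
  from gram_eigenvalue_nonneg(2)[OF A v(1,2) this] t show False by simp
qed

lemma resolvent_inverse:
  assumes A: "A \<in> carrier_mat n n" and t: "t > 0"
  shows "shifted_gram t A * resolvent t A = 1\<^sub>m n" "resolvent t A * shifted_gram t A = 1\<^sub>m n"
proof -
  note adj = adj_mat[OF shifted_gram_carrier[OF A], of t]
  have c: "inverse (Determinant.det (shifted_gram t A)) \<cdot>\<^sub>m
    (Determinant.det (shifted_gram t A) \<cdot>\<^sub>m 1\<^sub>m n) = 1\<^sub>m n"
    using det_shifted_gram_nonzero[OF A t] by (auto intro!: eq_matI)
  show "shifted_gram t A * resolvent t A = 1\<^sub>m n"
    unfolding resolvent_def using adj A
    by (subst mult_smult_distrib[of _ n n _ n]) (auto simp: c)
  show "resolvent t A * shifted_gram t A = 1\<^sub>m n"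
    unfolding resolvent_def using adj A
    by (subst mult_smult_assoc_mat[of _ n n _ n]) (auto simp: c)
qed

lemma mat_adjoint_shifted_gram:
  assumes A: "A \<in> carrier_mat n n"
  shows "mat_adjoint (shifted_gram t A) = shifted_gram t A"
proof -
  have h: "mat_adjoint (mat_adjoint A * A) = mat_adjoint A * A"
    using A by (subst mat_adjoint_mult[of _ n n _ n]) auto
  show ?thesis
  proof (rule eq_matI)
    fix i j assume ij: "i < dim_row (shifted_gram t A)" "j < dim_col (shifted_gram t A)"
    have "conjugate ((mat_adjoint A * A) $$ (j, i)) = (mat_adjoint A * A) $$ (i, j)"
      using ij A by (subst (2) h[symmetric], subst mat_adjoint_index) (auto simp: shifted_gram_def)
    then show "mat_adjoint (shifted_gram t A) $$ (i, j) = shifted_gram t A $$ (i, j)"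
      using ij A unfolding shifted_gram_def by (auto simp del: index_mult_mat(1))
  qed (use A in \<open>auto simp: shifted_gram_def\<close>)
qed

lemma mat_adjoint_resolvent:
  assumes A: "A \<in> carrier_mat n n" and t: "t > 0"
  shows "mat_adjoint (resolvent t A) = resolvent t A"
proof -
  let ?M = "shifted_gram t A" and ?R = "resolvent t A"
  have "mat_adjoint ?R * ?M = mat_adjoint (?M * ?R)"
    using A by (subst mat_adjoint_mult[of _ n n _ n]) (auto simp: mat_adjoint_shifted_gram[OF A])
  also have "\<dots> = 1\<^sub>m n"
    unfolding resolvent_inverse[OF A t] by (rule eq_matI) auto
  finally have 1: "mat_adjoint ?R * ?M = 1\<^sub>m n" .
  have "mat_adjoint ?R = mat_adjoint ?R * (?M * ?R)"
    using A resolvent_inverse[OF A t] by (simp add: right_mult_one_mat[of _ n n])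
  also have "\<dots> = (mat_adjoint ?R * ?M) * ?R"
    using A by (intro assoc_mult_mat[symmetric, of _ n n _ n _ n]) auto
  also have "\<dots> = ?R" unfolding 1 using A by (intro left_mult_one_mat) auto
  finally show ?thesis .
qed

lemma resolvent_mult_gram:
  assumes A: "A \<in> carrier_mat n n" and t: "t > 0"
  shows "resolvent t A * (mat_adjoint A * A) + of_real t \<cdot>\<^sub>m resolvent t A = 1\<^sub>m n"
    (is "?R * ?G + _ = _")
proof -
  have "1\<^sub>m n = ?R * (?G + of_real t \<cdot>\<^sub>m 1\<^sub>m n)"
    using resolvent_inverse(2)[OF A t] A by (simp add: shifted_gram_def)
  also have "\<dots> = ?R * ?G + ?R * (of_real t \<cdot>\<^sub>m 1\<^sub>m n)"
    using A by (intro mult_add_distrib_mat[of _ n n _ n]) auto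
  also have "?R * (of_real t \<cdot>\<^sub>m 1\<^sub>m n) = of_real t \<cdot>\<^sub>m ?R"
    using A by (simp add: mult_smult_distrib[of _ n n _ n] right_mult_one_mat[of _ n n])
  finally show ?thesis ..
qed

text \<open>Integration by parts is applied to A_ij times the (j, i) entry of this matrix; the sum
  of these products over i and j is the trace of \<open>sandwich\<close>.\<close>

definition resolvent_adj :: "real \<Rightarrow> complex mat \<Rightarrow> complex mat" where
  "resolvent_adj t A = resolvent t A * mat_adjoint A"

definition sandwich :: "real \<Rightarrow> complex mat \<Rightarrow> complex mat" where
  "sandwich t A = A * resolvent_adj t A"

lemma resolvent_adj_dim [simp]:
  "dim_row (resolvent_adj t A) = dim_col A" "dim_col (resolvent_adj t A) = dim_row A"
  by (auto simp: resolvent_adj_def)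

lemma sandwich_dim [simp]:
  "dim_row (sandwich t A) = dim_row A" "dim_col (sandwich t A) = dim_row A"
  by (auto simp: sandwich_def)

lemma resolvent_adj_carrier [simp, intro]:
  "A \<in> carrier_mat n n \<Longrightarrow> resolvent_adj t A \<in> carrier_mat n n"
  by (auto simp: resolvent_adj_def intro!: mult_carrier_mat)

lemma sandwich_carrier [simp, intro]:
  "A \<in> carrier_mat n n \<Longrightarrow> sandwich t A \<in> carrier_mat n n"
  by (auto simp: sandwich_def intro!: mult_carrier_mat)

lemma mat_adjoint_resolvent_adj:
  assumes A: "A \<in> carrier_mat n n" and t: "t > 0"
  shows "mat_adjoint (resolvent_adj t A) = A * resolvent t A"
  using A unfolding resolvent_adj_def
  by (subst mat_adjoint_mult[of _ n n _ n]) (auto simp: mat_adjoint_resolvent[OF A t])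

lemma mat_adjoint_sandwich:
  assumes A: "A \<in> carrier_mat n n" and t: "t > 0"
  shows "mat_adjoint (sandwich t A) = sandwich t A"
proof -
  have "mat_adjoint (A * resolvent_adj t A) = A * resolvent t A * mat_adjoint A"
    using A by (subst mat_adjoint_mult[of _ n n _ n]) (auto simp: mat_adjoint_resolvent_adj[OF A t])
  also have "\<dots> = A * resolvent_adj t A"
    using A unfolding resolvent_adj_def by (intro assoc_mult_mat[of _ n n _ n _ n]) auto
  finally show ?thesis by (simp add: sandwich_def)
qed

text \<open>Multiply R (A^H A) + t R = 1 by R on the right and use that R is Hermitian. Diagonal
  entries of R thereby become sums of squares, which replaces an appeal to the spectral
  theorem.\<close>

lemma resolvent_eq_sum_squares:
  assumes A: "A \<in> carrier_mat n n" and t: "t > 0"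
  shows "resolvent t A = resolvent_adj t A * mat_adjoint (resolvent_adj t A)
    + of_real t \<cdot>\<^sub>m (resolvent t A * mat_adjoint (resolvent t A))"
proof -
  let ?R = "resolvent t A"
  have "?R = (?R * (mat_adjoint A * A) + of_real t \<cdot>\<^sub>m ?R) * ?R"
    unfolding resolvent_mult_gram[OF A t] using A by (simp add: left_mult_one_mat[of _ n n])
  also have "\<dots> = ?R * (mat_adjoint A * A) * ?R + of_real t \<cdot>\<^sub>m ?R * ?R"
    using A by (intro add_mult_distrib_mat[of _ n n _ _ n]) auto
  also have "?R * (mat_adjoint A * A) * ?R = resolvent_adj t A * (A * ?R)"
    using A by (simp add: resolvent_adj_def assoc_mult_mat[of _ n n _ n _ n])
  also have "of_real t \<cdot>\<^sub>m ?R * ?R = of_real t \<cdot>\<^sub>m (?R * ?R)"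
    using A by (simp add: mult_smult_assoc_mat[of _ n n _ n])
  finally show ?thesis
    by (simp add: mat_adjoint_resolvent_adj[OF A t] mat_adjoint_resolvent[OF A t])
qed

text \<open>The analogue for P = A R A^H is P = P^2 + t (A R)(A R)^H, where A R is the adjoint of
  \<open>resolvent_adj\<close>.\<close>

lemma sandwich_eq_sum_squares:
  assumes A: "A \<in> carrier_mat n n" and t: "t > 0"
  shows "sandwich t A = sandwich t A * mat_adjoint (sandwich t A)
    + of_real t \<cdot>\<^sub>m (mat_adjoint (resolvent_adj t A) * mat_adjoint (mat_adjoint (resolvent_adj t A)))"
proof -
  let ?R = "resolvent t A" and ?B = "resolvent_adj t A"
  have "?B = (?R * (mat_adjoint A * A) + of_real t \<cdot>\<^sub>m ?R) * ?B"
    unfolding resolvent_mult_gram[OF A t] using A by (simp add: left_mult_one_mat[of _ n n])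
  also have "\<dots> = ?R * (mat_adjoint A * A) * ?B + of_real t \<cdot>\<^sub>m ?R * ?B"
    using A by (intro add_mult_distrib_mat[of _ n n _ _ n]) auto
  also have "?R * (mat_adjoint A * A) * ?B = ?B * sandwich t A"
    using A by (simp add: sandwich_def resolvent_adj_def assoc_mult_mat[of _ n n _ n _ n])
  also have "of_real t \<cdot>\<^sub>m ?R * ?B = of_real t \<cdot>\<^sub>m (?R * ?B)"
    using A by (simp add: mult_smult_assoc_mat[of _ n n _ n])
  finally have "A * ?B = A * (?B * sandwich t A + of_real t \<cdot>\<^sub>m (?R * ?B))"
    by simp
  also have "\<dots> = A * (?B * sandwich t A) + A * (of_real t \<cdot>\<^sub>m (?R * ?B))"
    using A by (intro mult_add_distrib_mat[of _ n n _ n]) auto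
  also have "A * (of_real t \<cdot>\<^sub>m (?R * ?B)) = of_real t \<cdot>\<^sub>m (A * (?R * ?B))"
    using A by (intro mult_smult_distrib[of _ n n _ n]) auto
  also have "A * (?R * ?B) = A * ?R * ?B"
    using A by (intro assoc_mult_mat[symmetric, of _ n n _ n _ n]) auto
  also have "A * (?B * sandwich t A) = sandwich t A * sandwich t A"
    using A by (subst sandwich_def, subst (2) sandwich_def)
      (auto simp: assoc_mult_mat[of _ n n _ n _ n] sandwich_def)
  finally show ?thesis
    unfolding mat_adjoint_adjoint mat_adjoint_sandwich[OF A t]
    by (simp add: sandwich_def mat_adjoint_resolvent_adj[OF A t])
qed

lemma mult_adjoint_diag:
  fixes X :: "complex mat"
  assumes X: "X \<in> carrier_mat n n" and i: "i < n"
  shows "(X * mat_adjoint X) $$ (i, i) = of_real (\<Sum>k<n. (cmod (X $$ (i, k)))\<^sup>2)"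
  using assms
  by (subst mat_mult_index[of _ n n _ n]) (auto simp: complex_norm_square simp del: of_real_power)

lemma resolvent_diag:
  assumes A: "A \<in> carrier_mat n n" and t: "t > 0" and j: "j < n"
  shows "resolvent t A $$ (j, j) = of_real ((\<Sum>i<n. (cmod (resolvent_adj t A $$ (j, i)))\<^sup>2)
    + t * (\<Sum>k<n. (cmod (resolvent t A $$ (j, k)))\<^sup>2))"
proof -
  let ?X = "resolvent_adj t A" and ?R = "resolvent t A"
  have "?R $$ (j, j) = (?X * mat_adjoint ?X + of_real t \<cdot>\<^sub>m (?R * mat_adjoint ?R)) $$ (j, j)"
    using resolvent_eq_sum_squares[OF A t] by simp
  also have "\<dots> = (?X * mat_adjoint ?X) $$ (j, j) + of_real t * (?R * mat_adjoint ?R) $$ (j, j)"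
    using A j by (subst index_add_mat) (auto simp del: index_mult_mat(1))
  finally show ?thesis
    using A j by (simp add: mult_adjoint_diag[of _ n] del: index_mult_mat(1))
qed

lemma sandwich_diag:
  assumes A: "A \<in> carrier_mat n n" and t: "t > 0" and i: "i < n"
  shows "sandwich t A $$ (i, i) = of_real ((\<Sum>k<n. (cmod (sandwich t A $$ (i, k)))\<^sup>2)
    + t * (\<Sum>j<n. (cmod (resolvent_adj t A $$ (j, i)))\<^sup>2))"
proof -
  let ?B = "resolvent_adj t A" and ?P = "sandwich t A"
  let ?X = "mat_adjoint ?B"
  have "?P $$ (i, i) = (?P * mat_adjoint ?P + of_real t \<cdot>\<^sub>m (?X * mat_adjoint ?X)) $$ (i, i)"
    using sandwich_eq_sum_squares[OF A t] by simp
  also have "\<dots> = (?P * mat_adjoint ?P) $$ (i, i) + of_real t * (?X * mat_adjoint ?X) $$ (i, i)"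
    using A i by (subst index_add_mat) (auto simp del: index_mult_mat(1) mat_adjoint_adjoint)
  also have "(?X * mat_adjoint ?X) $$ (i, i) = of_real (\<Sum>j<n. (cmod (?X $$ (i, j)))\<^sup>2)"
    using A i by (intro mult_adjoint_diag) auto
  also have "(\<Sum>j<n. (cmod (?X $$ (i, j)))\<^sup>2) = (\<Sum>j<n. (cmod (?B $$ (j, i)))\<^sup>2)"
    using A i by (intro sum.cong) auto
  finally show ?thesis
    using A i by (simp add: mult_adjoint_diag[of _ n] del: index_mult_mat(1))
qed

text \<open>Write r for the diagonal entry and S for the squared norm of row j of
  \<open>resolvent_adj\<close>. As r^2 is one term of the row sum for R, the sum-of-squares identity
  gives S + t r^2 <= r. This bounds r by 1 / t and S by the maximum of r - t r^2, uniformly in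
  A.\<close>

lemma resolvent_bounds:
  assumes A: "A \<in> carrier_mat n n" and t: "t > 0" and j: "j < n"
  shows "resolvent t A $$ (j, j) = of_real (Re (resolvent t A $$ (j, j)))"
    and "0 \<le> Re (resolvent t A $$ (j, j))" and "Re (resolvent t A $$ (j, j)) \<le> 1 / t"
    and "(\<Sum>i<n. (cmod (resolvent_adj t A $$ (j, i)))\<^sup>2) \<le> 1 / (4 * t)"
proof -
  let ?r = "Re (resolvent t A $$ (j, j))"
  let ?S = "\<Sum>i<n. (cmod (resolvent_adj t A $$ (j, i)))\<^sup>2"
  let ?T = "\<Sum>k<n. (cmod (resolvent t A $$ (j, k)))\<^sup>2"
  note d = resolvent_diag[OF A t j]
  show real: "resolvent t A $$ (j, j) = of_real ?r"
    unfolding d by simp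
  have r: "?r = ?S + t * ?T" unfolding d by simp
  have S: "?S \<ge> 0" and T: "?T \<ge> 0" by (auto intro: sum_nonneg)
  show "0 \<le> ?r" unfolding r using S T t by simp
  have "?r\<^sup>2 = (cmod (resolvent t A $$ (j, j)))\<^sup>2" by (subst (2) real) simp
  also have "\<dots> \<le> ?T" using j by (intro member_le_sum) auto
  finally have "t * ?r\<^sup>2 \<le> t * ?T" using t by simp
  then have q: "?S + t * ?r\<^sup>2 \<le> ?r" using r by simp
  then have "(t * ?r) * ?r \<le> 1 * ?r" using S by (simp add: power2_eq_square)
  then show "?r \<le> 1 / t"
    using t \<open>0 \<le> ?r\<close> by (cases "?r = 0") (auto simp: field_simps mult_le_cancel_right)
  \<comment> \<open>Completed square: r - t r^2 attains its maximum 1 / (4 t) at r = 1 / (2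
    t).\<close>
  have "0 \<le> (2 * t * ?r - 1)\<^sup>2" by simp
  then have "4 * t * (?r - t * ?r\<^sup>2) \<le> 1" by (simp add: power2_eq_square algebra_simps)
  moreover have "4 * t * ?S \<le> 4 * t * (?r - t * ?r\<^sup>2)" using q t by (intro mult_left_mono) auto
  ultimately show "?S \<le> 1 / (4 * t)" using t by (simp add: field_simps)
qed

lemma resolvent_adj_bound:
  assumes A: "A \<in> carrier_mat n n" and t: "t > 0" and "j < n" "i < n"
  shows "(cmod (resolvent_adj t A $$ (j, i)))\<^sup>2 \<le> 1 / (4 * t)"
proof -
  have "(cmod (resolvent_adj t A $$ (j, i)))\<^sup>2 \<le> (\<Sum>i<n. (cmod (resolvent_adj t A $$ (j, i)))\<^sup>2)"
    using assms by (intro member_le_sum) auto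
  with resolvent_bounds(4)[OF A t \<open>j < n\<close>] show ?thesis by simp
qed

text \<open>The argument for the resolvent carries over and gives p^2 <= p for a diagonal entry
  p.\<close>

lemma sandwich_bounds:
  assumes A: "A \<in> carrier_mat n n" and t: "t > 0" and i: "i < n"
  shows "sandwich t A $$ (i, i) = of_real (Re (sandwich t A $$ (i, i)))"
    and "0 \<le> Re (sandwich t A $$ (i, i))" and "Re (sandwich t A $$ (i, i)) \<le> 1"
proof -
  let ?p = "Re (sandwich t A $$ (i, i))"
  let ?S = "\<Sum>j<n. (cmod (resolvent_adj t A $$ (j, i)))\<^sup>2"
  let ?T = "\<Sum>k<n. (cmod (sandwich t A $$ (i, k)))\<^sup>2"
  note d = sandwich_diag[OF A t i]
  show real: "sandwich t A $$ (i, i) = of_real ?p"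
    unfolding d by simp
  have p: "?p = ?T + t * ?S" unfolding d by simp
  have S: "?S \<ge> 0" and T: "?T \<ge> 0" by (auto intro: sum_nonneg)
  show "0 \<le> ?p" unfolding p using S T t by simp
  have "?p\<^sup>2 = (cmod (sandwich t A $$ (i, i)))\<^sup>2" by (subst (2) real) simp
  also have "\<dots> \<le> ?T" using i by (intro member_le_sum) auto
  also have "\<dots> \<le> ?p" unfolding p using S t by simp
  finally have "?p * ?p \<le> 1 * ?p" by (simp add: power2_eq_square)
  then show "?p \<le> 1"
    using \<open>0 \<le> ?p\<close> by (cases "?p = 0") (auto simp: mult_le_cancel_right)
qed

text \<open>Cyclicity of the trace turns A R A^H into R A^H A, which equals 1 - t R.\<close>

lemma sum_sandwich_diag:
  assumes A: "A \<in> carrier_mat n n" and t: "t > 0"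
  shows "(\<Sum>i<n. sandwich t A $$ (i, i)) = of_nat n - of_real t * (\<Sum>j<n. resolvent t A $$ (j, j))"
proof -
  let ?R = "resolvent t A" and ?B = "resolvent_adj t A"
  have BA: "(?B * A) $$ (j, j) = 1 - of_real t * ?R $$ (j, j)" if j: "j < n" for j
  proof -
    have "(?R * (mat_adjoint A * A) + of_real t \<cdot>\<^sub>m ?R) $$ (j, j) = 1"
      unfolding resolvent_mult_gram[OF A t] using j by simp
    moreover have "?R * (mat_adjoint A * A) = ?B * A"
      using A by (simp add: resolvent_adj_def assoc_mult_mat[of _ n n _ n _ n])
    ultimately have "(?B * A) $$ (j, j) + of_real t * ?R $$ (j, j) = 1"
      using j A by (auto simp del: index_mult_mat(1))
    then show ?thesis by (simp add: algebra_simps)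
  qed
  have "(\<Sum>i<n. sandwich t A $$ (i, i)) = (\<Sum>i<n. \<Sum>j<n. A $$ (i, j) * ?B $$ (j, i))"
    unfolding sandwich_def using A by (intro sum.cong mat_mult_index[of _ n n _ n]) auto
  also have "\<dots> = (\<Sum>j<n. \<Sum>i<n. ?B $$ (j, i) * A $$ (i, j))"
    by (subst sum.swap) (simp add: mult.commute)
  also have "\<dots> = (\<Sum>j<n. (?B * A) $$ (j, j))"
    using A by (intro sum.cong mat_mult_index[of _ n n _ n, symmetric]) auto
  also have "\<dots> = (\<Sum>j<n. 1 - of_real t * ?R $$ (j, j))"
    using BA by (intro sum.cong) auto
  finally show ?thesis by (simp add: sum_subtractf sum_distrib_left)
qed

section \<open>Trace formula and single-entry perturbations\<close>

lemma sum_diag_mult_commute: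
  fixes X Y :: "complex mat"
  assumes "X \<in> carrier_mat n n" "Y \<in> carrier_mat n n"
  shows "(\<Sum>i<n. (X * Y) $$ (i, i)) = (\<Sum>i<n. (Y * X) $$ (i, i))"
proof -
  have "(\<Sum>i<n. (X * Y) $$ (i, i)) = (\<Sum>i<n. \<Sum>j<n. X $$ (i, j) * Y $$ (j, i))"
    using assms by (intro sum.cong mat_mult_index) auto
  also have "\<dots> = (\<Sum>j<n. \<Sum>i<n. Y $$ (j, i) * X $$ (i, j))"
    by (subst sum.swap) (simp add: mult.commute)
  also have "\<dots> = (\<Sum>j<n. (Y * X) $$ (j, j))"
    using assms by (intro sum.cong mat_mult_index[symmetric]) auto
  finally show ?thesis .
qed

text \<open>Rows are treated from the last one upwards. In row i of T C the terms k < i vanish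
  because T is upper triangular, and the terms k > i vanish by induction in every column j <= i, so
  only T_ii C_ij remains.\<close>

lemma upper_triangular_right_inverse_diag:
  fixes T C :: "complex mat"
  assumes T: "T \<in> carrier_mat n n" "upper_triangular T" and C: "C \<in> carrier_mat n n"
    and TC: "T * C = 1\<^sub>m n" and nz: "\<And>i. i < n \<Longrightarrow> T $$ (i, i) \<noteq> 0" and i: "i < n"
  shows "(\<forall>j<i. C $$ (i, j) = 0) \<and> C $$ (i, i) = 1 / T $$ (i, i)"
  using i
proof (induction "n - i" arbitrary: i rule: less_induct)
  case less
  have row: "T $$ (i, i) * C $$ (i, j) = (if i = j then 1 else 0)" if j: "j \<le> i" for j
  proof -
    have "(\<Sum>k<n. T $$ (i, k) * C $$ (k, j)) = (if i = j then 1 else 0)"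
      using mat_mult_index[OF T(1) C, of i j] TC j less.prems by auto
    moreover have "(\<Sum>k<n. T $$ (i, k) * C $$ (k, j)) = (\<Sum>k\<in>{i}. T $$ (i, k) * C $$ (k, j))"
    proof (rule sum.mono_neutral_right)
      show "\<forall>k\<in>{..<n} - {i}. T $$ (i, k) * C $$ (k, j) = 0"
      proof
        fix k assume k: "k \<in> {..<n} - {i}"
        show "T $$ (i, k) * C $$ (k, j) = 0"
        proof (cases "k < i")
          case True
          then show ?thesis using T less.prems by (auto simp: upper_triangular_def)
        next
          case False
          then have "C $$ (k, j) = 0"
            using less.hyps[of k] k j by auto
          then show ?thesis by simp
        qed
      qed
    qed (use less.prems in auto)
    ultimately show ?thesis by simp
  qed
  show ?case
  proof (intro conjI allI impI)
    fix j assume "j < i"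
    then show "C $$ (i, j) = 0" using row[of j] nz[OF less.prems] by simp
  next
    show "C $$ (i, i) = 1 / T $$ (i, i)" using row[of i] nz[OF less.prems] by (simp add: field_simps)
  qed
qed

lemma gram_roots:
  fixes A :: "complex mat"
  assumes A: "A \<in> carrier_mat n n" and e: "e \<in># proots (char_poly (mat_adjoint A * A))"
  shows "e \<in> \<real>" "Re e \<ge> 0"
proof -
  have G: "mat_adjoint A * A \<in> carrier_mat n n" using A by simp
  have "char_poly (mat_adjoint A * A) \<noteq> 0"
    using degree_monic_char_poly[OF G] by auto
  then have "eigenvalue (mat_adjoint A * A) e"
    using e unfolding eigenvalue_root_char_poly[OF G] by simp
  then obtain v where "v \<in> carrier_vec n" "v \<noteq> 0\<^sub>v n" "(mat_adjoint A * A) *\<^sub>v v = e \<cdot>\<^sub>v v"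
    using G by (auto simp: eigenvalue_def eigenvector_def)
  from gram_eigenvalue_nonneg[OF A this] show "e \<in> \<real>" "Re e \<ge> 0" by auto
qed

lemma proots_prod_list_linear:
  "proots (\<Prod>a\<leftarrow>as. [:- a, 1:]) = mset (as :: complex list)"
proof (induction as)
  case (Cons a as)
  have "(\<Prod>a\<leftarrow>as. [:- a, 1:]) \<noteq> 0" by (auto simp: prod_list_zero_iff)
  then have "proots ([:- a, 1:] * (\<Prod>a\<leftarrow>as. [:- a, 1:])) = proots [:- a, 1:] + mset as"
    using Cons by (subst proots_mult) auto
  then show ?case by (simp add: proots_linear_factor)
qed simp

text \<open>Take a Schur form A^H A = P T Q, with Q inverse to P. Then C = Q R P is a right inverse
  of the triangular matrix T + t, has the same trace as R, and carries the numbers 1 / (e + t) on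
  its diagonal. The diagonal of T lists the eigenvalues with algebraic multiplicity, as
  \<open>singular_values\<close> counts them.\<close>

lemma trace_resolvent:
  assumes A: "A \<in> carrier_mat n n" and t: "t > 0"
  shows "(\<Sum>j<n. resolvent t A $$ (j, j))
    = (\<Sum>e\<in>#proots (char_poly (mat_adjoint A * A)). 1 / (e + of_real t))"
    and "size (proots (char_poly (mat_adjoint A * A))) = n"
proof -
  let ?G = "mat_adjoint A * A" and ?R = "resolvent t A" and ?M = "shifted_gram t A"
  have G: "?G \<in> carrier_mat n n" using A by simp
  obtain es where es: "char_poly ?G = (\<Prod>a\<leftarrow>es. [:- a, 1:])" "length es = n"
    using char_poly_factorized[OF G] by auto
  have roots: "proots (char_poly ?G) = mset es"
    unfolding es by (rule proots_prod_list_linear)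
  then show "size (proots (char_poly ?G)) = n" using es by simp
  obtain T P Q where "schur_decomposition ?G es = (T, P, Q)" by (metis prod_cases3)
  from schur_decomposition[OF G es(1) this]
  have wit: "similar_mat_wit ?G T P Q" and T: "upper_triangular T" "diag_mat T = es" by auto
  note w = similar_mat_witD2[OF G wit]
  have diag: "es ! i = T $$ (i, i)" if "i < n" for i
    using T(2)[symmetric] w that by (auto simp: diag_mat_def)
  define T' where "T' = T + of_real t \<cdot>\<^sub>m 1\<^sub>m n"
  have T': "T' \<in> carrier_mat n n" "upper_triangular T'"
    using w T by (auto simp: T'_def upper_triangular_def)
  have T'_diag: "T' $$ (i, i) = es ! i + of_real t" if "i < n" for i
    using that w diag by (auto simp: T'_def)
  have QG: "Q * ?G = T * Q"
  proof -
    have "Q * ?G = Q * (P * T * Q)" using w(3) by simp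
    also have "\<dots> = (Q * P) * (T * Q)"
      using w(4-) by (simp add: assoc_mult_mat[of _ n n _ n _ n])
    also have "\<dots> = T * Q" unfolding w(2) using w by (intro left_mult_one_mat) auto
    finally show ?thesis .
  qed
  have TQ: "T' * Q = Q * ?M"
  proof -
    have "T' * Q = T * Q + of_real t \<cdot>\<^sub>m 1\<^sub>m n * Q"
      unfolding T'_def using w by (intro add_mult_distrib_mat[of _ n n _ _ n]) auto
    also have "of_real t \<cdot>\<^sub>m 1\<^sub>m n * Q = Q * (of_real t \<cdot>\<^sub>m 1\<^sub>m n)"
      using w by (simp add: mult_smult_assoc_mat[of _ n n _ n] mult_smult_distrib[of _ n n _ n])
    also have "T * Q + Q * (of_real t \<cdot>\<^sub>m 1\<^sub>m n) = Q * (?G + of_real t \<cdot>\<^sub>m 1\<^sub>m n)"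
      unfolding QG[symmetric] using w G by (intro mult_add_distrib_mat[symmetric, of _ n n _ n]) auto
    finally show ?thesis using A by (simp add: shifted_gram_def)
  qed
  define C where "C = Q * (?R * P)"
  have C: "C \<in> carrier_mat n n" using w A by (auto simp: C_def)
  have "T' * C = (T' * Q) * (?R * P)"
    unfolding C_def using w T' A by (intro assoc_mult_mat[symmetric, of _ n n _ n _ n]) auto
  also have "\<dots> = Q * ((?M * ?R) * P)"
    unfolding TQ using w A by (simp add: assoc_mult_mat[of _ n n _ n _ n])
  also have "\<dots> = 1\<^sub>m n"
    unfolding resolvent_inverse[OF A t] using w by (simp add: left_mult_one_mat[of _ n n])
  finally have TC: "T' * C = 1\<^sub>m n" .
  have nz: "T' $$ (i, i) \<noteq> 0" if i: "i < n" for i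
  proof -
    have "es ! i \<in># proots (char_poly ?G)" using i es(2) roots by simp
    from gram_roots[OF A this] t have "Re (es ! i + of_real t) > 0" by simp
    then show ?thesis unfolding T'_diag[OF i] by (metis less_irrefl zero_complex.sel(1))
  qed
  have "(\<Sum>j<n. ?R $$ (j, j)) = (\<Sum>j<n. ((?R * P) * Q) $$ (j, j))"
  proof -
    have "(?R * P) * Q = ?R * (P * Q)"
      using w A by (intro assoc_mult_mat[of _ n n _ n _ n]) auto
    also have "\<dots> = ?R" unfolding w(1) using A by (intro right_mult_one_mat) auto
    finally show ?thesis by simp
  qed
  also have "\<dots> = (\<Sum>j<n. C $$ (j, j))"
    unfolding C_def using w A by (intro sum_diag_mult_commute) auto
  also have "\<dots> = (\<Sum>j<n. 1 / (es ! j + of_real t))"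
    using upper_triangular_right_inverse_diag[OF T' C TC nz] T'_diag by (intro sum.cong) auto
  also have "\<dots> = (\<Sum>e\<leftarrow>es. 1 / (e + of_real t))"
    using es(2) by (simp add: sum_list_sum_nth atLeast0LessThan)
  also have "\<dots> = (\<Sum>e\<in>#proots (char_poly ?G). 1 / (e + of_real t))"
    unfolding roots by (metis mset_map sum_mset_sum_list)
  finally show "(\<Sum>j<n. ?R $$ (j, j))
    = (\<Sum>e\<in>#proots (char_poly ?G). 1 / (e + of_real t))" .
qed

section \<open>Perturbation of a single matrix entry\<close>

definition single_entry :: "nat \<Rightarrow> nat \<Rightarrow> nat \<Rightarrow> complex \<Rightarrow> complex mat" where
  "single_entry n i j \<beta> = mat n n (\<lambda>(k, l). if k = i \<and> l = j then \<beta> else 0)"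

lemma single_entry_carrier [simp]: "single_entry n i j \<beta> \<in> carrier_mat n n"
  by (simp add: single_entry_def)

lemma single_entry_dim [simp]:
  "dim_row (single_entry n i j \<beta>) = n" "dim_col (single_entry n i j \<beta>) = n"
  by (auto simp: single_entry_def)

lemma mult_single_entry_index:
  assumes X: "X \<in> carrier_mat n n" and Y: "Y \<in> carrier_mat n n"
    and "i < n" "j < n" "k < n" "l < n"
  shows "(X * (single_entry n i j \<beta> * Y)) $$ (k, l) = \<beta> * X $$ (k, i) * Y $$ (j, l)"
proof -
  have inner: "(single_entry n i j \<beta> * Y) $$ (m, l) = (if m = i then \<beta> * Y $$ (j, l) else 0)"
    if m: "m < n" for m
  proof -
    have "(single_entry n i j \<beta> * Y) $$ (m, l)
        = (\<Sum>q<n. (if q = j then (if m = i then \<beta> * Y $$ (j, l) else 0) else 0))"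
      using assms m unfolding mat_mult_index[OF single_entry_carrier Y m \<open>l < n\<close>]
      by (intro sum.cong) (auto simp: single_entry_def)
    then show ?thesis using assms by simp
  qed
  have "(X * (single_entry n i j \<beta> * Y)) $$ (k, l)
      = (\<Sum>m<n. X $$ (k, m) * (single_entry n i j \<beta> * Y) $$ (m, l))"
    using assms by (intro mat_mult_index) auto
  also have "\<dots> = (\<Sum>m<n. if m = i then \<beta> * X $$ (k, i) * Y $$ (j, l) else 0)"
    using inner by (intro sum.cong) auto
  finally show ?thesis using assms by simp
qed

context
  fixes n i j :: nat and t :: real and A A' :: "complex mat" and \<beta> :: complex
  assumes A: "A \<in> carrier_mat n n" and t: "t > 0" and i: "i < n" and j: "j < n"
    and A': "A' = A + single_entry n i j \<beta>"
begin

lemma perturbed_carrier: "A' \<in> carrier_mat n n"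
  using A by (simp add: A')

lemma mat_adjoint_perturbed: "mat_adjoint A' = mat_adjoint A + single_entry n j i (cnj \<beta>)"
  using A by (intro eq_matI) (auto simp: A' single_entry_def)

text \<open>The increment is split asymmetrically, with A' in one term and A in the other, so that
  it is exact without a separate term quadratic in \<beta>.\<close>

lemma shifted_gram_perturbed:
  "shifted_gram t A' = shifted_gram t A
    + (mat_adjoint A' * single_entry n i j \<beta> + single_entry n j i (cnj \<beta>) * A)"
proof -
  let ?D = "single_entry n i j \<beta>" and ?E = "single_entry n j i (cnj \<beta>)"
  note c = A perturbed_carrier
  have "mat_adjoint A' * A' = mat_adjoint A' * A + mat_adjoint A' * ?D"
    unfolding A'[symmetric] using c
    by (subst (2) A', intro mult_add_distrib_mat[of _ n n _ n]) auto
  also have "mat_adjoint A' * A = mat_adjoint A * A + ?E * A"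
    using c unfolding mat_adjoint_perturbed by (intro add_mult_distrib_mat[of _ n n _ _ n]) auto
  finally have "mat_adjoint A' * A' = mat_adjoint A * A + ?E * A + mat_adjoint A' * ?D" .
  then show ?thesis
    using c unfolding shifted_gram_def by (intro eq_matI) (auto simp del: index_mult_mat(1))
qed

text \<open>Second resolvent identity: R = R' M' R with the increment of M' inserted. Keeping R' on
  the left and R on the right makes every outer factor a matrix with known entry bounds; A R is the
  adjoint of \<open>resolvent_adj\<close>.\<close>

lemma resolvent_perturbed:
  "resolvent t A = resolvent t A'
    + (resolvent_adj t A' * (single_entry n i j \<beta> * resolvent t A)
      + resolvent t A' * (single_entry n j i (cnj \<beta>) * (A * resolvent t A)))"
proof -
  let ?D = "single_entry n i j \<beta>" and ?E = "single_entry n j i (cnj \<beta>)"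
  let ?R = "resolvent t A" and ?R' = "resolvent t A'"
  let ?M = "shifted_gram t A" and ?M' = "shifted_gram t A'"
  note c = A perturbed_carrier
  have "?R = ?R' * ?M' * ?R"
    unfolding resolvent_inverse[OF c(2) t] using c by (intro left_mult_one_mat[symmetric]) auto
  also have "\<dots> = ?R' * ((?M + (mat_adjoint A' * ?D + ?E * A)) * ?R)"
    unfolding shifted_gram_perturbed[symmetric] using c
    by (intro assoc_mult_mat[of _ n n _ n _ n]) auto
  also have "(?M + (mat_adjoint A' * ?D + ?E * A)) * ?R
      = ?M * ?R + (mat_adjoint A' * ?D + ?E * A) * ?R"
    using c by (intro add_mult_distrib_mat[of _ n n _ _ n]) auto
  also have "(mat_adjoint A' * ?D + ?E * A) * ?R = mat_adjoint A' * ?D * ?R + ?E * A * ?R"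
    using c by (intro add_mult_distrib_mat[of _ n n _ _ n]) auto
  also have "?R' * (?M * ?R + (mat_adjoint A' * ?D * ?R + ?E * A * ?R))
      = ?R' * (?M * ?R) + ?R' * (mat_adjoint A' * ?D * ?R + ?E * A * ?R)"
    using c by (intro mult_add_distrib_mat[of _ n n _ n]) auto
  also have "?R' * (mat_adjoint A' * ?D * ?R + ?E * A * ?R)
      = ?R' * (mat_adjoint A' * ?D * ?R) + ?R' * (?E * A * ?R)"
    using c by (intro mult_add_distrib_mat[of _ n n _ n]) auto
  also have "?R' * (mat_adjoint A' * ?D * ?R) = resolvent_adj t A' * (?D * ?R)"
    using c by (simp add: resolvent_adj_def assoc_mult_mat[of _ n n _ n _ n])
  also have "?R' * (?E * A * ?R) = ?R' * (?E * (A * ?R))"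
    using c by (simp add: assoc_mult_mat[of _ n n _ n _ n])
  also have "?R' * (?M * ?R) = ?R'"
    unfolding resolvent_inverse[OF A t] using c by (intro right_mult_one_mat) auto
  finally show ?thesis .
qed

text \<open>Makes the diagonal of the resolvent Lipschitz in one entry. This continuity is needed to
  pass to the limit in the difference quotient of \<open>resolvent_adj\<close>.\<close>

lemma resolvent_diag_perturbed:
  "resolvent t A $$ (j, j) = resolvent t A' $$ (j, j)
    + \<beta> * resolvent_adj t A' $$ (j, i) * resolvent t A $$ (j, j)
    + cnj \<beta> * resolvent t A' $$ (j, j) * cnj (resolvent_adj t A $$ (j, i))"
proof -
  let ?X = "resolvent_adj t A' * (single_entry n i j \<beta> * resolvent t A)"
  let ?Y = "resolvent t A' * (single_entry n j i (cnj \<beta>) * (A * resolvent t A))"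
  note c = A perturbed_carrier
  have "A * resolvent t A = mat_adjoint (resolvent_adj t A)"
    using mat_adjoint_resolvent_adj[OF A t] by simp
  then have AR: "(A * resolvent t A) $$ (i, j) = cnj (resolvent_adj t A $$ (j, i))"
    using A i j by simp
  have "resolvent t A $$ (j, j) = (resolvent t A' + (?X + ?Y)) $$ (j, j)"
    using resolvent_perturbed by simp
  also have "\<dots> = resolvent t A' $$ (j, j) + (?X $$ (j, j) + ?Y $$ (j, j))"
    using c i j by (auto simp del: index_mult_mat(1))
  also have "?X $$ (j, j) = \<beta> * resolvent_adj t A' $$ (j, i) * resolvent t A $$ (j, j)"
    using c i j by (intro mult_single_entry_index) auto
  also have "?Y $$ (j, j) = cnj \<beta> * resolvent t A' $$ (j, j) * (A * resolvent t A) $$ (i, j)"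
    using c i j by (intro mult_single_entry_index) auto
  finally show ?thesis unfolding AR by (simp add: add.assoc)
qed

text \<open>An exact finite difference: together with the entrywise bounds it provides both the Lipschitz
  bound and the derivative that integration by parts requires.\<close>
lemma resolvent_adj_perturbed:
  "resolvent_adj t A' $$ (j, i) - resolvent_adj t A $$ (j, i)
    = cnj \<beta> * resolvent t A' $$ (j, j) * (1 - sandwich t A $$ (i, i))
      - \<beta> * resolvent_adj t A' $$ (j, i) * resolvent_adj t A $$ (j, i)"
proof -
  let ?D = "single_entry n i j \<beta>" and ?E = "single_entry n j i (cnj \<beta>)"
  let ?R = "resolvent t A" and ?R' = "resolvent t A'"
  let ?B = "resolvent_adj t A" and ?B' = "resolvent_adj t A'" and ?P = "sandwich t A"
  let ?X = "?B' * (?D * ?B)" and ?Y = "?R' * (?E * ?P)" and ?Z = "?R' * (?E * 1\<^sub>m n)"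
  note c = A perturbed_carrier
  have "?B = (?R' + (?B' * (?D * ?R) + ?R' * (?E * (A * ?R)))) * mat_adjoint A"
    unfolding resolvent_perturbed[symmetric] by (simp add: resolvent_adj_def)
  also have "\<dots> = ?R' * mat_adjoint A + (?B' * (?D * ?R) + ?R' * (?E * (A * ?R))) * mat_adjoint A"
    using c by (intro add_mult_distrib_mat[of _ n n _ _ n]) auto
  also have "(?B' * (?D * ?R) + ?R' * (?E * (A * ?R))) * mat_adjoint A
      = ?B' * (?D * ?R) * mat_adjoint A + ?R' * (?E * (A * ?R)) * mat_adjoint A"
    using c by (intro add_mult_distrib_mat[of _ n n _ _ n]) auto
  also have "?B' * (?D * ?R) * mat_adjoint A = ?X"
    using c unfolding resolvent_adj_def[of t A] by (simp add: assoc_mult_mat[of _ n n _ n _ n])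
  also have "?R' * (?E * (A * ?R)) * mat_adjoint A = ?Y"
    using c unfolding sandwich_def resolvent_adj_def[of t A]
    by (simp add: assoc_mult_mat[of _ n n _ n _ n])
  finally have B: "?B = ?R' * mat_adjoint A + (?X + ?Y)" .
  have B': "?B' = ?R' * mat_adjoint A + ?Z"
    unfolding resolvent_adj_def mat_adjoint_perturbed using c
    by (subst mult_add_distrib_mat[of _ n n _ n]) (auto simp: right_mult_one_mat[of _ n n])
  have "?B $$ (j, i) = (?R' * mat_adjoint A + (?X + ?Y)) $$ (j, i)"
    using B by simp
  also have "\<dots> = (?R' * mat_adjoint A) $$ (j, i) + (?X $$ (j, i) + ?Y $$ (j, i))"
    using c i j by (auto simp del: index_mult_mat(1))
  finally have 1: "?B $$ (j, i) = (?R' * mat_adjoint A) $$ (j, i) + (?X $$ (j, i) + ?Y $$ (j, i))" .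
  have "?B' $$ (j, i) = (?R' * mat_adjoint A + ?Z) $$ (j, i)"
    using B' by simp
  also have "\<dots> = (?R' * mat_adjoint A) $$ (j, i) + ?Z $$ (j, i)"
    using c i j by (auto simp del: index_mult_mat(1))
  finally have 2: "?B' $$ (j, i) = (?R' * mat_adjoint A) $$ (j, i) + ?Z $$ (j, i)" .
  have X: "?X $$ (j, i) = \<beta> * ?B' $$ (j, i) * ?B $$ (j, i)"
    using c i j by (intro mult_single_entry_index) auto
  have Y: "?Y $$ (j, i) = cnj \<beta> * ?R' $$ (j, j) * ?P $$ (i, i)"
    using c i j by (intro mult_single_entry_index) auto
  have Z: "?Z $$ (j, i) = cnj \<beta> * ?R' $$ (j, j) * 1\<^sub>m n $$ (i, i)"
    using c i j by (intro mult_single_entry_index) auto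
  show ?thesis using 1 2 X Y Z i by (simp add: algebra_simps)
qed

end

section \<open>Gaussian integration by parts\<close>

text \<open>A common form for real and complex entries, in which 1 / l is the variance of each real
  coordinate. The constant c stays unspecified and is determined by total mass 1.\<close>

definition gaussian :: "real \<Rightarrow> real \<Rightarrow> 'a :: euclidean_space measure" where
  "gaussian c l = density lborel (\<lambda>x. ennreal (c * exp (- (l / 2) * (norm x)\<^sup>2)))"

lemma sets_gaussian [simp, measurable_cong]: "sets (gaussian c l) = sets borel"
  by (simp add: gaussian_def)

lemma space_gaussian [simp]: "space (gaussian c l) = UNIV"
  by (simp add: gaussian_def)

text \<open>Cameron--Martin formula: Lebesgue measure is translation invariant, and expanding |x -
  h|^2 in the exponent leaves the old density times the exponential weight.\<close>

lemma gaussian_translate: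
  fixes h :: "'a :: euclidean_space"
  shows "distr (gaussian c l) borel ((+) h)
    = density (gaussian c l) (\<lambda>x. ennreal (exp (l * inner x h - l / 2 * (norm h)\<^sup>2)))"
proof -
  let ?p = "\<lambda>x :: 'a. ennreal (c * exp (- (l / 2) * (norm x)\<^sup>2))"
  have "distr (gaussian c l) borel ((+) h)
      = distr (density lborel (\<lambda>x. ?p ((h + x) - h))) borel ((+) h)"
    by (simp add: gaussian_def)
  also have "\<dots> = density (distr lborel borel ((+) h)) (\<lambda>x. ?p (x - h))"
    by (rule density_distr[symmetric]) auto
  also have "\<dots> = density lborel (\<lambda>x. ?p (x - h))"
    by (simp add: lborel_distr_plus)
  also have "(\<lambda>x. ?p (x - h))
      = (\<lambda>x. ?p x * ennreal (exp (l * inner x h - l / 2 * (norm h)\<^sup>2)))"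
  proof
    fix x :: 'a
    have "(norm (x - h))\<^sup>2 = (norm x)\<^sup>2 - 2 * inner x h + (norm h)\<^sup>2"
      by (simp add: power2_norm_eq_inner inner_diff_left inner_diff_right inner_commute)
    then have "- (l / 2) * (norm (x - h))\<^sup>2
        = - (l / 2) * (norm x)\<^sup>2 + (l * inner x h - l / 2 * (norm h)\<^sup>2)"
      by (simp only:) (simp add: algebra_simps)
    then show "?p (x - h) = ?p x * ennreal (exp (l * inner x h - l / 2 * (norm h)\<^sup>2))"
      by (simp only: exp_add mult.assoc[symmetric]) (simp add: ennreal_mult'')
  qed
  finally show ?thesis
    by (simp add: gaussian_def density_density_eq)
qed

locale gaussian_product =
  fixes \<mu> :: "'a :: euclidean_space measure" and c l :: real and I :: "'i set"
  assumes gaussian: "\<mu> = gaussian c l" and prob: "prob_space \<mu>" and l_pos: "l > 0"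
    and finite_index: "finite I"
begin

sublocale marginal: prob_space \<mu> by (rule prob)

sublocale product_prob_space "\<lambda>_. \<mu>" I
  by unfold_locales

lemma sets_marginal [simp, measurable_cong]: "sets \<mu> = sets borel"
  by (simp add: gaussian)

lemma space_marginal [simp]: "space \<mu> = UNIV"
  by (simp add: gaussian)

text \<open>A translated measure still has mass 1, so its Cameron--Martin weight is integrable. The
  shift v / l makes that weight a multiple of the desired exponential.\<close>

lemma integrable_exp_marginal: "integrable \<mu> (\<lambda>x. exp (inner x v))"
proof -
  define h where "h = v /\<^sub>R l"
  have "(\<integral>\<^sup>+x. ennreal (exp (l * inner x h - l / 2 * (norm h)\<^sup>2)) \<partial>\<mu>)
      = emeasure (density \<mu> (\<lambda>x. ennreal (exp (l * inner x h - l / 2 * (norm h)\<^sup>2)))) UNIV"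
    by (subst emeasure_density) auto
  also have "\<dots> = emeasure (distr \<mu> borel ((+) h)) UNIV"
    by (simp add: gaussian gaussian_translate)
  also have "\<dots> = 1"
    using marginal.emeasure_space_1 by (subst emeasure_distr) auto
  finally have "integrable \<mu> (\<lambda>x. exp (l * inner x h - l / 2 * (norm h)\<^sup>2))"
    by (intro integrableI_nonneg) auto
  then have "integrable \<mu> (\<lambda>x. exp (l / 2 * (norm h)\<^sup>2) * exp (l * inner x h - l / 2 * (norm h)\<^sup>2))"
    by (rule integrable_mult_right)
  also have "(\<lambda>x. exp (l / 2 * (norm h)\<^sup>2) * exp (l * inner x h - l / 2 * (norm h)\<^sup>2))
      = (\<lambda>x. exp (inner x v))"
    using l_pos by (auto simp: exp_add[symmetric] h_def)
  finally show ?thesis .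
qed

lemma integrable_exp_joint:
  assumes "e \<in> I"
  shows "integrable (PiM I (\<lambda>_. \<mu>)) (\<lambda>X. exp (inner (X e) v))"
proof -
  have "integrable (distr (PiM I (\<lambda>_. \<mu>)) \<mu> (\<lambda>X. X e)) (\<lambda>x. exp (inner x v))"
    using integrable_exp_marginal PiM_component[OF assms] by simp
  then show ?thesis
    using assms by (subst (asm) integrable_distr_eq) auto
qed

lemma measurable_joint_update [measurable]:
  assumes "e \<in> I"
  shows "(\<lambda>X. X(e := h + X e)) \<in> measurable (PiM I (\<lambda>_. \<mu>)) (PiM I (\<lambda>_. \<mu>))"
proof -
  have "I = I \<union> {e}" using assms by auto
  then show ?thesis using assms by (intro measurable_fun_upd[of I I e]) auto
qed

text \<open>Fubini splits off coordinate e, on which the translation formula for the marginal acts.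
  The weight is unbounded, so integrability of the weighted function comes from exponential
  moments.\<close>

lemma joint_translate:
  fixes f :: "('i \<Rightarrow> 'a) \<Rightarrow> complex"
  assumes e: "e \<in> I" and f [measurable]: "f \<in> borel_measurable (PiM I (\<lambda>_. \<mu>))"
    and bound: "\<And>X. cmod (f X) \<le> K"
  shows "(\<integral>X. f (X(e := h + X e)) \<partial>PiM I (\<lambda>_. \<mu>))
    = (\<integral>X. exp (l * inner (X e) h - l / 2 * (norm h)\<^sup>2) *\<^sub>R f X \<partial>PiM I (\<lambda>_. \<mu>))"
    and "integrable (PiM I (\<lambda>_. \<mu>)) (\<lambda>X. exp (l * inner (X e) h - l / 2 * (norm h)\<^sup>2) *\<^sub>R f X)"
proof -
  let ?w = "\<lambda>x. exp (l * inner x h - l / 2 * (norm h)\<^sup>2)"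
  define J where "J = I - {e}"
  have J: "finite J" "e \<notin> J" "I = insert e J" using finite_index e by (auto simp: J_def)
  have [measurable]: "(\<lambda>X. X e) \<in> borel_measurable (PiM I (\<lambda>_. \<mu>))"
    using e measurable_component_singleton[of e I "\<lambda>_. \<mu>"] by simp
  have int1: "integrable (PiM I (\<lambda>_. \<mu>)) (\<lambda>X. f (X(e := h + X e)))"
    using e bound by (intro P.integrable_const_bound[where B = K]) auto
  have iw: "integrable (PiM I (\<lambda>_. \<mu>)) (\<lambda>X. K * ?w (X e))"
  proof -
    have "(\<lambda>X. K * ?w (X e))
        = (\<lambda>X. K * exp (- l / 2 * (norm h)\<^sup>2) * exp (inner (X e) (l *\<^sub>R h)))"
      by (auto simp: mult.assoc exp_add[symmetric])
    then show ?thesis using integrable_exp_joint[OF e, of "l *\<^sub>R h"] by simp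
  qed
  show int2: "integrable (PiM I (\<lambda>_. \<mu>)) (\<lambda>X. ?w (X e) *\<^sub>R f X)"
  proof (rule Bochner_Integration.integrable_bound[OF iw])
    have "?w (X e) * cmod (f X) \<le> \<bar>K\<bar> * ?w (X e)" for X
      using bound[of X] by (subst mult.commute) (intro mult_right_mono, auto)
    then show "AE X in PiM I (\<lambda>_. \<mu>). norm (?w (X e) *\<^sub>R f X) \<le> norm (K * ?w (X e))"
      by (auto simp: abs_mult)
  qed auto
  have inner_eq: "(\<integral>y. f (X(e := h + y)) \<partial>\<mu>) = (\<integral>y. ?w y *\<^sub>R f (X(e := y)) \<partial>\<mu>)"
    if X: "X \<in> space (PiM J (\<lambda>_. \<mu>))" for X
  proof -
    have [measurable]: "(\<lambda>y. f (X(e := y))) \<in> borel_measurable \<mu>"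
      using X f unfolding J(3) by (auto intro!: measurable_compose[OF _ f[unfolded J(3)]]
        measurable_fun_upd[where J = J] simp: J)
    then have m: "(\<lambda>y. f (X(e := y))) \<in> borel_measurable borel"
      by (simp cong: measurable_cong_sets)
    have "(\<integral>y. f (X(e := h + y)) \<partial>\<mu>) = (\<integral>y. f (X(e := y)) \<partial>distr \<mu> borel ((+) h))"
      using m by (subst integral_distr) (auto simp: measurable_cong_sets[OF sets_marginal refl])
    also have "distr \<mu> borel ((+) h) = density \<mu> (\<lambda>x. ennreal (?w x))"
      by (simp add: gaussian gaussian_translate)
    also have "(\<integral>y. f (X(e := y)) \<partial>density \<mu> (\<lambda>x. ennreal (?w x)))
        = (\<integral>y. ?w y *\<^sub>R f (X(e := y)) \<partial>\<mu>)"
      by (intro integral_density) (use m in \<open>auto simp: measurable_cong_sets[OF sets_marginal refl]\<close>)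
    finally show ?thesis .
  qed
  have "(\<integral>X. f (X(e := h + X e)) \<partial>PiM I (\<lambda>_. \<mu>))
      = (\<integral>X. (\<integral>y. f (X(e := h + y)) \<partial>\<mu>) \<partial>PiM J (\<lambda>_. \<mu>))"
    using product_integral_insert[OF J(1,2) int1[unfolded J(3)]] J(3) by simp
  also have "\<dots> = (\<integral>X. (\<integral>y. ?w y *\<^sub>R f (X(e := y)) \<partial>\<mu>) \<partial>PiM J (\<lambda>_. \<mu>))"
    by (rule Bochner_Integration.integral_cong[OF refl inner_eq])
  also have "\<dots> = (\<integral>X. ?w (X e) *\<^sub>R f X \<partial>PiM I (\<lambda>_. \<mu>))"
    using product_integral_insert[OF J(1,2) int2[unfolded J(3)]] J(3) by simp
  finally show "(\<integral>X. f (X(e := h + X e)) \<partial>PiM I (\<lambda>_. \<mu>))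
    = (\<integral>X. ?w (X e) *\<^sub>R f X \<partial>PiM I (\<lambda>_. \<mu>))" .
qed

text \<open>A majorant independent of the shift s, for dominated convergence. It rests on |exp u -
  1| <= |u| exp |u| with |u| <= s v, followed by v <= exp v. Bounding exp (2 l |y|) by a sum of two
  exponentials brings it within reach of \<open>integrable_exp_joint\<close>.\<close>

lemma exp_difference_quotient_bound:
  fixes s y :: real
  assumes s: "0 < s" "s \<le> 1"
  shows "\<bar>(exp (l * (y * s) - l / 2 * s\<^sup>2) - 1) / s\<bar> \<le> exp l * (exp (2 * l * y) + exp (- 2 * l * y))"
proof -
  define u where "u = l * (y * s) - l / 2 * s\<^sup>2"
  define v where "v = l * \<bar>y\<bar> + l / 2"
  have "\<bar>u\<bar> \<le> \<bar>l * (y * s)\<bar> + \<bar>l / 2 * s\<^sup>2\<bar>" unfolding u_def by (rule abs_triangle_ineq4)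
  also have "\<dots> = l * \<bar>y\<bar> * s + l / 2 * s * s"
    using s l_pos by (simp add: abs_mult power2_eq_square)
  also have "\<dots> \<le> l * \<bar>y\<bar> * s + l / 2 * s * 1"
    using s l_pos by (intro add_left_mono mult_left_mono) auto
  finally have u: "\<bar>u\<bar> \<le> s * v" by (simp add: v_def algebra_simps)
  have v: "v \<ge> 0" using l_pos by (simp add: v_def)
  have "s * v \<le> v" using s v by (simp add: mult_left_le_one_le)
  have "\<bar>exp u - 1\<bar> \<le> \<bar>u\<bar> * exp \<bar>u\<bar>"
  proof (cases "u \<ge> 0")
    case True
    have "exp u * (1 - u) \<le> exp u * exp (- u)"
      using exp_ge_add_one_self[of "- u"] by (intro mult_left_mono) auto
    then show ?thesis using True by (simp add: exp_minus algebra_simps)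
  next
    case False
    have "1 - exp u \<le> - u" using exp_ge_add_one_self[of u] by linarith
    also have "\<dots> \<le> - u * exp (- u)" using False by (simp add: mult_le_cancel_left1)
    finally show ?thesis using False by simp
  qed
  also have "\<dots> \<le> (s * v) * exp v"
    using u \<open>s * v \<le> v\<close> s v by (intro mult_mono) auto
  also have "\<dots> \<le> s * (exp v * exp v)"
  proof -
    have "v \<le> exp v" using exp_ge_add_one_self[of v] by linarith
    then have "s * (v * exp v) \<le> s * (exp v * exp v)" using s by (intro mult_left_mono mult_right_mono) auto
    then show ?thesis by (simp add: mult.assoc)
  qed
  finally have "\<bar>(exp u - 1) / s\<bar> \<le> exp v * exp v"
    using s by (simp add: field_simps abs_mult)
  also have "\<dots> = exp l * exp (2 * l * \<bar>y\<bar>)" by (simp add: exp_add[symmetric] v_def)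
  also have "\<dots> \<le> exp l * (exp (2 * l * y) + exp (- 2 * l * y))"
    by (intro mult_left_mono) (auto simp: abs_if)
  finally show ?thesis by (simp add: u_def)
qed

text \<open>Differentiates the translation identity at shift 0, along the shifts \<open>b / (n + 1)\<close>.\<close>
lemma gaussian_integration_by_parts:
  fixes f g :: "('i \<Rightarrow> 'a) \<Rightarrow> complex"
  assumes e: "e \<in> I" and b: "norm b = 1"
    and f [measurable]: "f \<in> borel_measurable (PiM I (\<lambda>_. \<mu>))"
    and bound: "\<And>X. cmod (f X) \<le> K"
    and lipschitz: "\<And>X s. 0 < s \<Longrightarrow> s \<le> 1 \<Longrightarrow> cmod (f (X(e := s *\<^sub>R b + X e)) - f X) \<le> L * s"
    and g [measurable]: "g \<in> borel_measurable (PiM I (\<lambda>_. \<mu>))"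
    and deriv: "\<And>X. (\<lambda>n. (f (X(e := (1 / real (Suc n)) *\<^sub>R b + X e)) - f X) / of_real (1 / real (Suc n)))
      \<longlonglongrightarrow> g X"
  shows "integrable (PiM I (\<lambda>_. \<mu>)) (\<lambda>X. inner (X e) b *\<^sub>R f X)"
    and "(\<integral>X. g X \<partial>PiM I (\<lambda>_. \<mu>)) = of_real l * (\<integral>X. inner (X e) b *\<^sub>R f X \<partial>PiM I (\<lambda>_. \<mu>))"
proof -
  let ?M = "PiM I (\<lambda>_. \<mu>)"
  let ?s = "\<lambda>n. 1 / real (Suc n)"
  let ?w = "\<lambda>s X. exp (l * inner (X e) (s *\<^sub>R b) - l / 2 * (norm (s *\<^sub>R b))\<^sup>2)"
  \<comment> \<open>Majorant for the weighted side of the translation identity; on the shifted side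
    the Lipschitz constant L serves as majorant.\<close>
  let ?D = "\<lambda>X. exp l * (exp (2 * l * inner (X e) b) + exp (- 2 * l * inner (X e) b))"
  have [measurable]: "(\<lambda>X. X e) \<in> borel_measurable ?M"
    using e measurable_component_singleton[of e I "\<lambda>_. \<mu>"] by simp
  have s: "0 < ?s n" "?s n \<le> 1" for n by auto
  have w: "?w (?s n) X = exp (l * (inner (X e) b * ?s n) - l / 2 * (?s n)\<^sup>2)" for n X
    using b by simp
  have D: "integrable ?M (\<lambda>X. K * ?D X)"
    using integrable_exp_joint[OF e, of "(2 * l) *\<^sub>R b"] integrable_exp_joint[OF e, of "(- 2 * l) *\<^sub>R b"]
    by (intro integrable_mult_right Bochner_Integration.integrable_add) auto
  have lim_w: "(\<lambda>n. (?w (?s n) X - 1) / ?s n) \<longlonglongrightarrow> l * inner (X e) b" for X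
  proof -
    have "((\<lambda>s. exp (l * (inner (X e) b * s) - l / 2 * s\<^sup>2)) has_real_derivative (l * inner (X e) b)) (at 0)"
      by (auto intro!: derivative_eq_intros)
    then have "((\<lambda>s. (exp (l * (inner (X e) b * s) - l / 2 * s\<^sup>2) - 1) / s) \<longlongrightarrow> l * inner (X e) b) (at 0)"
      by (simp add: DERIV_def)
    moreover have "filterlim ?s (at 0) sequentially"
      unfolding filterlim_at using LIMSEQ_inverse_real_of_nat by (auto simp: field_simps)
    ultimately have "(\<lambda>n. (exp (l * (inner (X e) b * ?s n) - l / 2 * (?s n)\<^sup>2) - 1) / ?s n) \<longlonglongrightarrow> l * inner (X e) b"
      by (rule filterlim_compose)
    then show ?thesis unfolding w .
  qed
  have dom: "norm (((?w (?s n) X - 1) / ?s n) *\<^sub>R f X) \<le> K * ?D X" for n X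
  proof -
    have "\<bar>(?w (?s n) X - 1) / ?s n\<bar> \<le> ?D X"
      unfolding w by (rule exp_difference_quotient_bound[OF s])
    then have "\<bar>(?w (?s n) X - 1) / ?s n\<bar> * cmod (f X) \<le> ?D X * K"
      using bound[of X] by (intro mult_mono) auto
    then show ?thesis by (simp only: norm_scaleR mult.commute)
  qed
  have conv: "(\<lambda>n. ((?w (?s n) X - 1) / ?s n) *\<^sub>R f X) \<longlonglongrightarrow> (l * inner (X e) b) *\<^sub>R f X" for X
    by (intro tendsto_intros lim_w)
  have int_lf: "integrable ?M (\<lambda>X. (l * inner (X e) b) *\<^sub>R f X)"
    by (rule integrable_dominated_convergence[where s = "\<lambda>n X. ((?w (?s n) X - 1) / ?s n) *\<^sub>R f X"
          and w = "\<lambda>X. K * ?D X"]) (use D conv dom in auto)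
  have rhs: "(\<lambda>n. \<integral>X. ((?w (?s n) X - 1) / ?s n) *\<^sub>R f X \<partial>?M)
      \<longlonglongrightarrow> (\<integral>X. (l * inner (X e) b) *\<^sub>R f X \<partial>?M)"
    by (rule integral_dominated_convergence[where w = "\<lambda>X. K * ?D X"]) (use D conv dom in auto)
  let ?q = "\<lambda>n X. (f (X(e := ?s n *\<^sub>R b + X e)) - f X) / of_real (?s n)"
  have [measurable]: "(\<lambda>X. f (X(e := h + X e))) \<in> borel_measurable ?M" for h
    using measurable_compose[OF measurable_joint_update[OF e] f] .
  have q_bound: "cmod (?q n X) \<le> L" for n X
  proof -
    have "cmod (f (X(e := ?s n *\<^sub>R b + X e)) - f X) / ?s n \<le> L"
      using lipschitz[OF s, of X n] by (subst pos_divide_le_eq[OF s(1)])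
    then show ?thesis unfolding norm_divide norm_of_real using s(1)[of n] by simp
  qed
  have lhs: "(\<lambda>n. \<integral>X. ?q n X \<partial>?M) \<longlonglongrightarrow> (\<integral>X. g X \<partial>?M)"
    by (rule integral_dominated_convergence[where w = "\<lambda>X. L"]) (use deriv q_bound in auto)
  have "(\<integral>X. ?q n X \<partial>?M) = (\<integral>X. ((?w (?s n) X - 1) / ?s n) *\<^sub>R f X \<partial>?M)" for n
  proof -
    have int_f: "integrable ?M f"
      using bound by (intro P.integrable_const_bound[where B = K]) auto
    have int_s: "integrable ?M (\<lambda>X. f (X(e := ?s n *\<^sub>R b + X e)))"
      using bound by (intro P.integrable_const_bound[where B = K]) auto
    note tr = joint_translate[OF e f bound, of "?s n *\<^sub>R b"]
    have "(\<integral>X. ?q n X \<partial>?M) = ((\<integral>X. f (X(e := ?s n *\<^sub>R b + X e)) \<partial>?M) - (\<integral>X. f X \<partial>?M)) / of_real (?s n)"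
      using int_f int_s by (simp add: Bochner_Integration.integral_diff del: of_real_divide)
    also have "\<dots> = ((\<integral>X. ?w (?s n) X *\<^sub>R f X \<partial>?M) - (\<integral>X. f X \<partial>?M)) / of_real (?s n)"
      unfolding tr(1) ..
    also have "\<dots> = (\<integral>X. (?w (?s n) X *\<^sub>R f X - f X) / of_real (?s n) \<partial>?M)"
      using int_f tr(2) by (simp add: Bochner_Integration.integral_diff del: of_real_divide)
    also have "\<dots> = (\<integral>X. ((?w (?s n) X - 1) / ?s n) *\<^sub>R f X \<partial>?M)"
      by (intro Bochner_Integration.integral_cong) (auto simp: scaleR_conv_of_real field_simps)
    finally show ?thesis .
  qed
  with lhs rhs have eq: "(\<integral>X. g X \<partial>?M) = (\<integral>X. (l * inner (X e) b) *\<^sub>R f X \<partial>?M)"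
    using LIMSEQ_unique by simp
  have "integrable ?M (\<lambda>X. (1 / l) *\<^sub>R ((l * inner (X e) b) *\<^sub>R f X))"
    using int_lf by (rule integrable_scaleR_right)
  then show "integrable ?M (\<lambda>X. inner (X e) b *\<^sub>R f X)"
    using l_pos by simp
  have "(\<integral>X. (l * inner (X e) b) *\<^sub>R f X \<partial>?M) = l *\<^sub>R (\<integral>X. inner (X e) b *\<^sub>R f X \<partial>?M)"
    by (simp only: scaleR_scaleR[symmetric] integral_scaleR_right)
  then show "(\<integral>X. g X \<partial>?M) = of_real l * (\<integral>X. inner (X e) b *\<^sub>R f X \<partial>?M)"
    unfolding eq by (simp only:) (rule scaleR_conv_of_real)
qed

end

section \<open>The loop equation\<close>

lemma borel_measurable_det:
  fixes F :: "'b \<Rightarrow> complex mat"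
  assumes "\<And>x. F x \<in> carrier_mat n n"
    and "\<And>k l. k < n \<Longrightarrow> l < n \<Longrightarrow> (\<lambda>x. F x $$ (k, l)) \<in> borel_measurable M"
  shows "(\<lambda>x. Determinant.det (F x)) \<in> borel_measurable M"
  unfolding det_def'[OF assms(1)]
proof (intro borel_measurable_sum borel_measurable_times borel_measurable_const borel_measurable_prod)
  fix p i assume "p \<in> {p. p permutes {0..<n}}" "i \<in> {0..<n}"
  then have "i < n" "p i < n" using permutes_in_image[of p "{0..<n}" i] by auto
  then show "(\<lambda>x. F x $$ (i, p i)) \<in> borel_measurable M" by (rule assms(2))
qed

lemma borel_measurable_mult_mat:
  fixes F G :: "'b \<Rightarrow> complex mat"
  assumes "\<And>x. F x \<in> carrier_mat n n" "\<And>x. G x \<in> carrier_mat n n"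
    and "\<And>k l. k < n \<Longrightarrow> l < n \<Longrightarrow> (\<lambda>x. F x $$ (k, l)) \<in> borel_measurable M"
    and "\<And>k l. k < n \<Longrightarrow> l < n \<Longrightarrow> (\<lambda>x. G x $$ (k, l)) \<in> borel_measurable M"
    and "i < n" "j < n"
  shows "(\<lambda>x. (F x * G x) $$ (i, j)) \<in> borel_measurable M"
  unfolding mat_mult_index[OF assms(1,2,5,6)]
  by (intro borel_measurable_sum borel_measurable_times assms(3,4)) (use assms(5,6) in auto)

lemma borel_measurable_mat_adjoint:
  fixes F :: "'b \<Rightarrow> complex mat"
  assumes F: "\<And>x. F x \<in> carrier_mat n n"
    and m: "\<And>k l. k < n \<Longrightarrow> l < n \<Longrightarrow> (\<lambda>x. F x $$ (k, l)) \<in> borel_measurable M"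
    and ij: "i < n" "j < n"
  shows "(\<lambda>x. mat_adjoint (F x) $$ (i, j)) \<in> borel_measurable M"
proof -
  have "mat_adjoint (F x) $$ (i, j) = cnj (F x $$ (j, i))" for x
    using F[of x] ij by auto
  then show ?thesis
    using measurable_compose[OF m[OF ij(2,1)], of cnj borel]
    by (simp add: borel_measurable_continuous_onI continuous_on_cnj)
qed

text \<open>The parameter t may vary with the point, because Tonelli's theorem will require joint
  measurability in the random matrix and the integration variable u.\<close>

lemma borel_measurable_resolvent:
  fixes F :: "'b \<Rightarrow> complex mat" and t :: "'b \<Rightarrow> real"
  assumes F: "\<And>x. F x \<in> carrier_mat n n"
    and m: "\<And>k l. k < n \<Longrightarrow> l < n \<Longrightarrow> (\<lambda>x. F x $$ (k, l)) \<in> borel_measurable M"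
    and t [measurable]: "t \<in> borel_measurable M"
    and ij: "i < n" "j < n"
  shows "(\<lambda>x. resolvent (t x) (F x) $$ (i, j)) \<in> borel_measurable M"
proof -
  let ?G = "\<lambda>x. shifted_gram (t x) (F x)"
  have G: "?G x \<in> carrier_mat n n" for x using F by simp
  have mG: "(\<lambda>x. ?G x $$ (k, l)) \<in> borel_measurable M" if kl: "k < n" "l < n" for k l
  proof -
    have "?G x $$ (k, l) = (mat_adjoint (F x) * F x) $$ (k, l) + of_real (t x) * 1\<^sub>m n $$ (k, l)" for x
      using F[of x] kl by (auto simp: shifted_gram_def simp del: index_mult_mat(1))
    moreover have "(\<lambda>x. (mat_adjoint (F x) * F x) $$ (k, l)) \<in> borel_measurable M"
      using F m kl by (intro borel_measurable_mult_mat[where n = n] borel_measurable_mat_adjoint[where n = n]) auto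
    ultimately show ?thesis by simp
  qed
  have det: "(\<lambda>x. Determinant.det (?G x)) \<in> borel_measurable M"
    by (rule borel_measurable_det[OF G mG])
  have "(\<lambda>x. Determinant.det (mat_delete (?G x) j i)) \<in> borel_measurable M"
  proof (rule borel_measurable_det)
    show "mat_delete (?G x) j i \<in> carrier_mat (n - 1) (n - 1)" for x
      using G by (rule mat_delete_carrier)
    fix k l assume kl: "k < n - 1" "l < n - 1"
    have "mat_delete (?G x) j i $$ (k, l)
        = ?G x $$ (if k < j then k else Suc k, if l < i then l else Suc l)" for x
      using G[of x] kl by (auto simp: mat_delete_def)
    then show "(\<lambda>x. mat_delete (?G x) j i $$ (k, l)) \<in> borel_measurable M"
      using kl by (auto intro!: mG)
  qed
  moreover have "resolvent (t x) (F x) $$ (i, j)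
      = inverse (Determinant.det (?G x)) * ((-1) ^ (j + i) * Determinant.det (mat_delete (?G x) j i))" for x
    using G[of x] ij by (auto simp: resolvent_def adj_mat_def cofactor_def)
  ultimately show ?thesis using det by simp
qed

lemma tendsto_of_norm_diff_le:
  fixes x :: "nat \<Rightarrow> complex"
  assumes "\<And>n. norm (x n - a) \<le> C * (1 / real (Suc n))"
  shows "x \<longlonglongrightarrow> a"
proof -
  have "(\<lambda>n. C * (1 / real (Suc n))) \<longlonglongrightarrow> C * 0"
    using LIMSEQ_inverse_real_of_nat by (intro tendsto_mult tendsto_const) (simp add: inverse_eq_divide)
  then have "(\<lambda>n. C * (1 / real (Suc n))) \<longlonglongrightarrow> 0" by (simp only: mult_zero_right)
  then have "(\<lambda>n. x n - a) \<longlonglongrightarrow> 0"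
    by (rule Lim_null_comparison[rotated]) (rule always_eventually, rule allI, rule assms)
  then show ?thesis by (rule LIM_zero_cancel)
qed

text \<open>An entry is a Gaussian vector of a Euclidean space, read as a complex number through the
  linear isometry \<iota>. The rate d times the dimension gives the vector expected squared norm 1 /
  d, whatever the dimension.\<close>

locale ginibre_ensemble =
  fixes \<mu> :: "'a :: euclidean_space measure" and c :: real and d :: nat and \<iota> :: "'a \<Rightarrow> complex"
  assumes gaussian_law: "\<mu> = gaussian c (real d * real DIM('a))" and prob_law: "prob_space \<mu>"
    and d_pos: "d > 0" and linear_\<iota>: "linear \<iota>" and norm_\<iota>: "cmod (\<iota> x) = norm x"
begin

sublocale gaussian_product \<mu> c "real d * real DIM('a)" "entries d"
proof (rule gaussian_product.intro)
  show "real d * real DIM('a) > 0" using d_pos DIM_positive[where 'a = 'a] by simp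
  show "finite (entries d)" by (simp add: entries_def)
qed (rule gaussian_law, rule prob_law)

abbreviation "ensemble \<equiv> PiM (entries d) (\<lambda>_. \<mu>)"

definition ensemble_mat :: "(nat \<times> nat \<Rightarrow> 'a) \<Rightarrow> complex mat" where
  "ensemble_mat X = mat d d (\<lambda>(i, j). \<iota> (X (i, j)))"

lemma ensemble_mat_carrier [simp]: "ensemble_mat X \<in> carrier_mat d d"
  by (simp add: ensemble_mat_def)

lemma ensemble_mat_dim [simp]:
  "dim_row (ensemble_mat X) = d" "dim_col (ensemble_mat X) = d"
  by (auto simp: ensemble_mat_def)

lemma ensemble_mat_index [simp]:
  "i < d \<Longrightarrow> j < d \<Longrightarrow> ensemble_mat X $$ (i, j) = \<iota> (X (i, j))"
  by (simp add: ensemble_mat_def)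

lemma ensemble_mat_update:
  "i < d \<Longrightarrow> j < d \<Longrightarrow> ensemble_mat (X((i, j) := s *\<^sub>R b + X (i, j)))
    = ensemble_mat X + single_entry d i j (of_real s * \<iota> b)"
  by (intro eq_matI)
     (auto simp: single_entry_def linear_add[OF linear_\<iota>] linear_scale[OF linear_\<iota>] scaleR_conv_of_real)

lemma borel_measurable_ensemble_mat:
  assumes "i < d" "j < d"
  shows "(\<lambda>X. \<iota> (X (i, j))) \<in> borel_measurable ensemble"
proof -
  have "(\<lambda>X. X (i, j)) \<in> measurable ensemble \<mu>"
    using assms by (intro measurable_component_singleton) (auto simp: entries_def)
  moreover have "\<iota> \<in> borel_measurable \<mu>"
    using linear_continuous_on[OF linear_conv_bounded_linear[THEN iffD1, OF linear_\<iota>], of UNIV]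
    by (simp add: measurable_cong_sets[OF sets_marginal refl] borel_measurable_continuous_onI)
  ultimately show ?thesis
    by (rule measurable_compose)
qed

text \<open>Equal to 1 for real and to 0 for complex entries; this is the only quantity through which the
  two ensembles differ.\<close>
definition pseudo_variance :: complex where
  "pseudo_variance = (\<Sum>b\<in>Basis. (\<iota> b)\<^sup>2)"

definition normalized_trace :: "real \<Rightarrow> (nat \<times> nat \<Rightarrow> 'a) \<Rightarrow> real" where
  "normalized_trace t X = (\<Sum>j<d. Re (resolvent t (ensemble_mat X) $$ (j, j))) / real d"

context
  fixes t :: real
  assumes t: "t > 0"
begin

abbreviation "res X j \<equiv> resolvent t (ensemble_mat X) $$ (j, j)"
abbreviation "resadj X j i \<equiv> resolvent_adj t (ensemble_mat X) $$ (j, i)"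
abbreviation "sand X i \<equiv> sandwich t (ensemble_mat X) $$ (i, i)"

lemma borel_measurable_res:
  assumes "k < d" "j < d"
  shows "(\<lambda>X. resolvent t (ensemble_mat X) $$ (k, j)) \<in> borel_measurable ensemble"
  by (rule borel_measurable_resolvent[where n = d])
     (use assms borel_measurable_ensemble_mat in auto)

lemma borel_measurable_resadj:
  assumes "j < d" "i < d"
  shows "(\<lambda>X. resadj X j i) \<in> borel_measurable ensemble"
  unfolding resolvent_adj_def
proof (rule borel_measurable_mult_mat[where n = d])
  fix k l assume kl: "k < d" "l < d"
  show "(\<lambda>X. resolvent t (ensemble_mat X) $$ (k, l)) \<in> borel_measurable ensemble"
    using kl by (rule borel_measurable_res)
  show "(\<lambda>X. mat_adjoint (ensemble_mat X) $$ (k, l)) \<in> borel_measurable ensemble"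
    by (rule borel_measurable_mat_adjoint[where n = d]) (use kl borel_measurable_ensemble_mat in auto)
qed (use assms in auto)

lemma borel_measurable_sand:
  assumes "i < d"
  shows "(\<lambda>X. sand X i) \<in> borel_measurable ensemble"
  unfolding sandwich_def
proof (rule borel_measurable_mult_mat[where n = d])
  fix k l assume kl: "k < d" "l < d"
  show "(\<lambda>X. ensemble_mat X $$ (k, l)) \<in> borel_measurable ensemble"
    using kl borel_measurable_ensemble_mat by simp
  show "(\<lambda>X. resolvent_adj t (ensemble_mat X) $$ (k, l)) \<in> borel_measurable ensemble"
    using kl by (rule borel_measurable_resadj)
qed (use assms in auto)

lemma norm_res:
  assumes j: "j < d"
  shows "cmod (res X j) \<le> 1 / t"
proof -
  note r = resolvent_bounds[OF ensemble_mat_carrier t j, of X]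
  have "cmod (res X j) = \<bar>Re (res X j)\<bar>" by (subst r(1)) (rule norm_of_real)
  then show ?thesis using r(2,3) by simp
qed

lemma norm_resadj: "j < d \<Longrightarrow> i < d \<Longrightarrow> cmod (resadj X j i) \<le> sqrt (1 / (4 * t))"
  using resolvent_adj_bound[OF ensemble_mat_carrier t, of j i X] by (intro real_le_rsqrt) auto

lemma norm_one_minus_sand: "i < d \<Longrightarrow> cmod (1 - sand X i) \<le> 1"
proof -
  assume i: "i < d"
  have "1 - sand X i = of_real (1 - Re (sand X i))"
    unfolding of_real_diff sandwich_bounds(1)[OF ensemble_mat_carrier t i, symmetric] by simp
  then show ?thesis
    using sandwich_bounds(2,3)[OF ensemble_mat_carrier t i, of X] by (simp only: norm_of_real)
qed

text \<open>Integration by parts for B_ji, where B = R A^H, in direction b of entry (i, j). Shifting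
  the entry by s b perturbs A with \<beta> = s \<iota>(b); dividing
  \<open>resolvent_adj_perturbed\<close> by s and letting s tend to 0 yields the integrand on the
  left.\<close>

lemma stein_identity:
  assumes ij: "i < d" "j < d" and b: "norm b = 1"
  shows "integrable ensemble (\<lambda>X. inner (X (i, j)) b *\<^sub>R resadj X j i)"
    and "(\<integral>X. cnj (\<iota> b) * (res X j * (1 - sand X i)) - \<iota> b * (resadj X j i)\<^sup>2 \<partial>ensemble)
      = of_real (real d * real DIM('a)) * (\<integral>X. inner (X (i, j)) b *\<^sub>R resadj X j i \<partial>ensemble)"
proof -
  let ?K = "sqrt (1 / (4 * t))"
  let ?up = "\<lambda>X s. X((i, j) := s *\<^sub>R b + X (i, j))"
  have \<beta>: "cmod (\<iota> b) = 1" using b norm_\<iota> by simp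
  have K: "?K \<ge> 0" using t by simp
  have quot: "resadj (?up X s) j i - resadj X j i
      = of_real s * (cnj (\<iota> b) * (res (?up X s) j * (1 - sand X i))
        - \<iota> b * (resadj (?up X s) j i * resadj X j i))" for X s
    using resolvent_adj_perturbed[OF ensemble_mat_carrier t ij ensemble_mat_update[OF ij, of X s b]]
    by (simp add: algebra_simps)
  have qbound: "cmod (cnj (\<iota> b) * (res (?up X s) j * (1 - sand X i))
        - \<iota> b * (resadj (?up X s) j i * resadj X j i)) \<le> 1 / t * 1 + ?K * ?K" for X s
  proof -
    have "cmod (cnj (\<iota> b) * (res (?up X s) j * (1 - sand X i))) \<le> 1 / t * 1"
      unfolding norm_mult complex_mod_cnj \<beta> mult_1
      using norm_res[OF ij(2)] norm_one_minus_sand[OF ij(1)] t by (intro mult_mono) auto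
    moreover have "cmod (\<iota> b * (resadj (?up X s) j i * resadj X j i)) \<le> ?K * ?K"
      unfolding norm_mult \<beta> mult_1
      using norm_resadj[OF ij(2,1)] K by (intro mult_mono) auto
    ultimately show ?thesis
      by (meson add_mono norm_triangle_ineq4 order_trans)
  qed
  define L where "L = 1 / t * 1 + ?K * ?K"
  have lip: "cmod (resadj (?up X s) j i - resadj X j i) \<le> L * s" if "0 < s" for X s
    unfolding quot norm_mult L_def using qbound[of X s] that
    by (subst mult.commute) (auto intro!: mult_right_mono simp del: mult_1_right)
  \<comment> \<open>The exact difference quotient still contains R_jj and B_ji at the shifted
    matrix. Both are Lipschitz in s and so tend to their unshifted values.\<close>
  have res_lip: "cmod (res (?up X s) j - res X j) \<le> (2 * (?K * (1 / t))) * s" if s: "0 < s" for X s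
  proof -
    let ?u = "\<iota> b * resadj (?up X s) j i * res X j" and ?v = "cnj (\<iota> b) * res (?up X s) j * cnj (resadj X j i)"
    have "res X j - res (?up X s) j = of_real s * (?u + ?v)"
      using resolvent_diag_perturbed[OF ensemble_mat_carrier t ij ensemble_mat_update[OF ij, of X s b]]
      by (simp add: algebra_simps)
    then have "cmod (res (?up X s) j - res X j) = s * cmod (?u + ?v)"
      using s by (subst norm_minus_commute) (simp add: norm_mult)
    also have "cmod ?u \<le> ?K * (1 / t)"
      unfolding norm_mult \<beta> mult_1
      using norm_resadj[OF ij(2,1)] norm_res[OF ij(2)] K by (intro mult_mono) auto
    moreover have "cmod ?v \<le> 1 / t * ?K"
      unfolding norm_mult complex_mod_cnj \<beta> mult_1
      using norm_resadj[OF ij(2,1)] norm_res[OF ij(2)] K t by (intro mult_mono) auto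
    ultimately have "cmod (?u + ?v) \<le> 2 * (?K * (1 / t))"
      using norm_triangle_ineq[of ?u ?v] by (simp add: mult.commute)
    then show ?thesis
      unfolding \<open>cmod (res (?up X s) j - res X j) = s * cmod (?u + ?v)\<close>
      using s by (subst mult.commute) (intro mult_right_mono, auto)
  qed
  have lim: "(\<lambda>n. (resadj (?up X (1 / real (Suc n))) j i - resadj X j i) / of_real (1 / real (Suc n)))
      \<longlonglongrightarrow> cnj (\<iota> b) * (res X j * (1 - sand X i)) - \<iota> b * (resadj X j i)\<^sup>2" for X
  proof -
    have 1: "(\<lambda>n. res (?up X (1 / real (Suc n))) j) \<longlonglongrightarrow> res X j"
      by (rule tendsto_of_norm_diff_le, rule res_lip) simp
    have 2: "(\<lambda>n. resadj (?up X (1 / real (Suc n))) j i) \<longlonglongrightarrow> resadj X j i"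
      by (rule tendsto_of_norm_diff_le, rule lip) simp
    have "(\<lambda>n. cnj (\<iota> b) * (res (?up X (1 / real (Suc n))) j * (1 - sand X i))
        - \<iota> b * (resadj (?up X (1 / real (Suc n))) j i * resadj X j i))
      \<longlonglongrightarrow> cnj (\<iota> b) * (res X j * (1 - sand X i)) - \<iota> b * (resadj X j i * resadj X j i)"
      by (intro tendsto_intros 1 2)
    moreover have nz: "complex_of_real (1 / real (Suc n)) \<noteq> 0" for n
      by (simp only: of_real_eq_0_iff) simp
    ultimately show ?thesis
      by (simp only: quot nonzero_mult_div_cancel_left[OF nz] power2_eq_square)
  qed
  have e: "(i, j) \<in> entries d" using ij by (simp add: entries_def)
  have g: "(\<lambda>X. cnj (\<iota> b) * (res X j * (1 - sand X i)) - \<iota> b * (resadj X j i)\<^sup>2)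
    \<in> borel_measurable ensemble"
    using ij by (intro borel_measurable_diff borel_measurable_times borel_measurable_const
      borel_measurable_power borel_measurable_res borel_measurable_resadj borel_measurable_sand)
  have lip': "cmod (resadj (?up X s) j i - resadj X j i) \<le> L * s" if "0 < s" "s \<le> 1" for X s
    using lip that by blast
  note ibp = gaussian_integration_by_parts[where f = "\<lambda>X. resadj X j i" and K = ?K and L = L and b = b
    and e = "(i, j)" and g = "\<lambda>X. cnj (\<iota> b) * (res X j * (1 - sand X i)) - \<iota> b * (resadj X j i)\<^sup>2",
    OF e b borel_measurable_resadj[OF ij(2,1)] norm_resadj[OF ij(2,1)] lip' g lim]
  show "integrable ensemble (\<lambda>X. inner (X (i, j)) b *\<^sub>R resadj X j i)"
    by (rule ibp(1))
  show "(\<integral>X. cnj (\<iota> b) * (res X j * (1 - sand X i)) - \<iota> b * (resadj X j i)\<^sup>2 \<partial>ensemble)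
    = of_real (real d * real DIM('a)) * (\<integral>X. inner (X (i, j)) b *\<^sub>R resadj X j i \<partial>ensemble)"
    by (rule ibp(2))
qed

lemma sum_res: "(\<Sum>j<d. res X j) = of_real (real d * normalized_trace t X)"
proof -
  have "(\<Sum>j<d. res X j) = (\<Sum>j<d. of_real (Re (res X j)))"
    using resolvent_bounds(1)[OF ensemble_mat_carrier t] by (intro sum.cong) auto
  then show ?thesis using d_pos by (simp add: normalized_trace_def)
qed

lemma sum_sand: "(\<Sum>i<d. sand X i) = of_real (real d * (1 - t * normalized_trace t X))"
  unfolding sum_sandwich_diag[OF ensemble_mat_carrier t] sum_res
  by (simp add: algebra_simps)

lemma sum_one_minus_sand: "(\<Sum>i<d. 1 - sand X i) = of_real (real d * (t * normalized_trace t X))"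
  by (simp add: sum_subtractf sum_sand algebra_simps)

lemma normalized_trace_bounds: "0 \<le> normalized_trace t X" "normalized_trace t X \<le> 1 / t"
proof -
  show "0 \<le> normalized_trace t X"
    unfolding normalized_trace_def
    using resolvent_bounds(2)[OF ensemble_mat_carrier t] by (intro divide_nonneg_nonneg sum_nonneg) auto
  have "(\<Sum>j<d. Re (res X j)) \<le> (\<Sum>j<d. 1 / t)"
    using resolvent_bounds(3)[OF ensemble_mat_carrier t] by (intro sum_mono) auto
  then show "normalized_trace t X \<le> 1 / t"
    using d_pos t by (simp add: normalized_trace_def field_simps)
qed

lemma borel_measurable_normalized_trace: "normalized_trace t \<in> borel_measurable ensemble"
  unfolding normalized_trace_def[abs_def]
  by (intro borel_measurable_divide borel_measurable_sum borel_measurable_const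
      measurable_compose[OF borel_measurable_res borel_measurable_Re]) auto

lemma integrable_normalized_trace: "integrable ensemble (normalized_trace t)"
  using normalized_trace_bounds borel_measurable_normalized_trace
  by (intro P.integrable_const_bound[where B = "1 / t"]) auto

lemma sum_norm_resadj: "(\<Sum>i<d. \<Sum>j<d. (cmod (resadj X j i))\<^sup>2) \<le> real d / (4 * t)"
proof -
  have "(\<Sum>i<d. \<Sum>j<d. (cmod (resadj X j i))\<^sup>2) = (\<Sum>j<d. \<Sum>i<d. (cmod (resadj X j i))\<^sup>2)"
    by (rule sum.swap)
  also have "\<dots> \<le> (\<Sum>j<d. 1 / (4 * t))"
    using resolvent_bounds(4)[OF ensemble_mat_carrier t] by (intro sum_mono) auto
  finally show ?thesis by simp
qed

lemma integrable_res_sand: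
  assumes "i < d" "j < d"
  shows "integrable ensemble (\<lambda>X. res X j * (1 - sand X i))"
proof (rule P.integrable_const_bound)
  have "cmod (res X j * (1 - sand X i)) \<le> 1 / t * 1" for X
    unfolding norm_mult using norm_res norm_one_minus_sand assms t by (intro mult_mono) auto
  then show "AE X in ensemble. cmod (res X j * (1 - sand X i)) \<le> 1 / t * 1" by simp
qed (use assms in \<open>intro borel_measurable_times borel_measurable_diff borel_measurable_const
  borel_measurable_res borel_measurable_sand\<close>)

lemma integrable_resadj_square:
  assumes "i < d" "j < d"
  shows "integrable ensemble (\<lambda>X. (resadj X j i)\<^sup>2)"
proof (rule P.integrable_const_bound)
  have "cmod ((resadj X j i)\<^sup>2) \<le> 1 / (4 * t)" for X
    unfolding norm_power using resolvent_adj_bound[OF ensemble_mat_carrier t] assms by blast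
  then show "AE X in ensemble. cmod ((resadj X j i)\<^sup>2) \<le> 1 / (4 * t)" by simp
qed (use assms in \<open>intro borel_measurable_power borel_measurable_resadj\<close>)

text \<open>Expand \<iota>(X_ij) in the basis and multiply the identity for b by \<iota>(b). Since
  |\<iota>(b)| = 1, the first term is counted once per basis vector, whereas the second collects the
  squares of \<iota>(b) into \<open>pseudo_variance\<close>.\<close>

lemma stein_identity_entry:
  assumes ij: "i < d" "j < d"
  shows "integrable ensemble (\<lambda>X. \<iota> (X (i, j)) * resadj X j i)"
    and "of_real (real d * real DIM('a)) * (\<integral>X. \<iota> (X (i, j)) * resadj X j i \<partial>ensemble)
      = of_nat DIM('a) * (\<integral>X. res X j * (1 - sand X i) \<partial>ensemble)
        - pseudo_variance * (\<integral>X. (resadj X j i)\<^sup>2 \<partial>ensemble)"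
proof -
  have \<iota>: "\<iota> x * z = (\<Sum>b\<in>Basis. \<iota> b * (inner x b *\<^sub>R z))" for x z
  proof -
    have "\<iota> x = \<iota> (\<Sum>b\<in>Basis. inner x b *\<^sub>R b)" by (simp add: euclidean_representation)
    also have "\<dots> = (\<Sum>b\<in>Basis. inner x b *\<^sub>R \<iota> b)"
      by (simp add: linear_sum[OF linear_\<iota>] linear_scale[OF linear_\<iota>])
    finally show ?thesis by (simp add: sum_distrib_right)
  qed
  have nb: "norm b = 1" if "b \<in> Basis" for b :: 'a using that by simp
  note st = stein_identity[OF ij nb]
  have eq: "(\<lambda>X. \<iota> (X (i, j)) * resadj X j i)
      = (\<lambda>X. \<Sum>b\<in>Basis. \<iota> b * (inner (X (i, j)) b *\<^sub>R resadj X j i))"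
    by (intro ext \<iota>)
  show "integrable ensemble (\<lambda>X. \<iota> (X (i, j)) * resadj X j i)"
    unfolding eq using st(1) by (intro Bochner_Integration.integrable_sum integrable_mult_right) auto
  have E: "(\<integral>X. \<iota> (X (i, j)) * resadj X j i \<partial>ensemble)
      = (\<Sum>b\<in>Basis. \<iota> b * (\<integral>X. inner (X (i, j)) b *\<^sub>R resadj X j i \<partial>ensemble))"
    unfolding eq using st(1)
    by (subst Bochner_Integration.integral_sum)
       (simp_all only: integrable_mult_right integral_mult_right_zero)
  let ?U = "\<integral>X. res X j * (1 - sand X i) \<partial>ensemble" and ?V = "\<integral>X. (resadj X j i)\<^sup>2 \<partial>ensemble"
  have each: "of_real (real d * real DIM('a)) * (\<iota> b * (\<integral>X. inner (X (i, j)) b *\<^sub>R resadj X j i \<partial>ensemble))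
      = ?U - (\<iota> b)\<^sup>2 * ?V" if b: "b \<in> Basis" for b
  proof -
    have "(\<integral>X. cnj (\<iota> b) * (res X j * (1 - sand X i)) - \<iota> b * (resadj X j i)\<^sup>2 \<partial>ensemble)
        = cnj (\<iota> b) * ?U - \<iota> b * ?V"
      using integrable_res_sand[OF ij] integrable_resadj_square[OF ij]
      by (subst Bochner_Integration.integral_diff) (auto simp del: power2_eq_square)
    then have "of_real (real d * real DIM('a)) * (\<integral>X. inner (X (i, j)) b *\<^sub>R resadj X j i \<partial>ensemble)
        = cnj (\<iota> b) * ?U - \<iota> b * ?V"
      using st(2)[OF b] by simp
    then have "\<iota> b * (of_real (real d * real DIM('a)) * (\<integral>X. inner (X (i, j)) b *\<^sub>R resadj X j i \<partial>ensemble))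
        = (\<iota> b * cnj (\<iota> b)) * ?U - (\<iota> b)\<^sup>2 * ?V"
      by (simp add: right_diff_distrib power2_eq_square mult.assoc)
    moreover have "\<iota> b * cnj (\<iota> b) = 1"
      using nb[OF b] norm_\<iota>[of b] by (simp add: complex_norm_square[symmetric])
    ultimately show ?thesis by (simp add: mult_ac)
  qed
  have "of_real (real d * real DIM('a)) * (\<integral>X. \<iota> (X (i, j)) * resadj X j i \<partial>ensemble)
      = (\<Sum>b\<in>(Basis :: 'a set). ?U - (\<iota> b)\<^sup>2 * ?V)"
    unfolding E sum_distrib_left using each by (intro sum.cong) auto
  also have "\<dots> = of_nat DIM('a) * ?U - pseudo_variance * ?V"
    by (simp add: sum_subtractf pseudo_variance_def sum_distrib_right)
  finally show "of_real (real d * real DIM('a)) * (\<integral>X. \<iota> (X (i, j)) * resadj X j i \<partial>ensemble)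
      = of_nat DIM('a) * ?U - pseudo_variance * ?V" .
qed

text \<open>Sum the entry identities over i and j. The left sides give the trace of
  \<open>sandwich\<close>; the first terms on the right factor into the sum of R_jj times the sum of
  1 - P_ii, which is d^2 t m^2; the remaining ones are controlled by the squared row norms of
  \<open>resolvent_adj\<close>, at most d / (4 t) in all.\<close>

lemma loop_equation:
  "\<bar>(1 - t * (\<integral>X. normalized_trace t X \<partial>ensemble)) - t * (\<integral>X. (normalized_trace t X)\<^sup>2 \<partial>ensemble)\<bar>
    \<le> cmod pseudo_variance / (real DIM('a) * real d) / (4 * t)"
proof -
  let ?m = "normalized_trace t" and ?D = "real DIM('a)"
  let ?W = "\<integral>X. (\<Sum>i<d. \<Sum>j<d. (resadj X j i)\<^sup>2) \<partial>ensemble"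
  have D: "?D > 0" using DIM_positive[where 'a = 'a] by simp
  have "(\<Sum>i<d. \<Sum>j<d. \<iota> (X (i, j)) * resadj X j i) = (\<Sum>i<d. sand X i)" for X
  proof (rule sum.cong)
    fix i assume "i \<in> {..<d}"
    then have "sand X i = (\<Sum>j<d. ensemble_mat X $$ (i, j) * resadj X j i)"
      unfolding sandwich_def by (intro mat_mult_index) auto
    then show "(\<Sum>j<d. \<iota> (X (i, j)) * resadj X j i) = sand X i"
      using \<open>i \<in> {..<d}\<close> by simp
  qed simp
  then have "(\<integral>X. (\<Sum>i<d. \<Sum>j<d. \<iota> (X (i, j)) * resadj X j i) \<partial>ensemble)
      = (\<integral>X. of_real (real d * (1 - t * ?m X)) \<partial>ensemble)"
    by (simp only: sum_sand)
  also have "\<dots> = of_real (\<integral>X. real d * (1 - t * ?m X) \<partial>ensemble)"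
    by (rule integral_complex_of_real)
  also have "(\<integral>X. real d * (1 - t * ?m X) \<partial>ensemble) = real d * (1 - t * (\<integral>X. ?m X \<partial>ensemble))"
    using integrable_normalized_trace P.prob_space by simp
  finally have lhs: "(\<integral>X. (\<Sum>i<d. \<Sum>j<d. \<iota> (X (i, j)) * resadj X j i) \<partial>ensemble)
      = of_real (real d * (1 - t * (\<integral>X. ?m X \<partial>ensemble)))" .
  have "(\<Sum>i<d. \<Sum>j<d. res X j * (1 - sand X i)) = of_real ((real d)\<^sup>2 * t * (?m X)\<^sup>2)" for X
  proof -
    have "(\<Sum>i<d. \<Sum>j<d. res X j * (1 - sand X i)) = (\<Sum>j<d. res X j) * (\<Sum>i<d. 1 - sand X i)"
      by (simp only: sum_product) (rule sum.swap)
    then show ?thesis unfolding sum_res sum_one_minus_sand by (simp add: power2_eq_square)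
  qed
  then have "(\<integral>X. (\<Sum>i<d. \<Sum>j<d. res X j * (1 - sand X i)) \<partial>ensemble)
      = (\<integral>X. of_real ((real d)\<^sup>2 * t * (?m X)\<^sup>2) \<partial>ensemble)"
    by (simp only:)
  also have "\<dots> = of_real (\<integral>X. (real d)\<^sup>2 * t * (?m X)\<^sup>2 \<partial>ensemble)"
    by (rule integral_complex_of_real)
  also have "(\<integral>X. (real d)\<^sup>2 * t * (?m X)\<^sup>2 \<partial>ensemble) = (real d)\<^sup>2 * t * (\<integral>X. (?m X)\<^sup>2 \<partial>ensemble)"
    by simp
  finally have rhs: "(\<integral>X. (\<Sum>i<d. \<Sum>j<d. res X j * (1 - sand X i)) \<partial>ensemble)
      = of_real ((real d)\<^sup>2 * t * (\<integral>X. (?m X)\<^sup>2 \<partial>ensemble))" .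
  have int_sum: "(\<integral>X. (\<Sum>i<d. \<Sum>j<d. f i j X) \<partial>ensemble) = (\<Sum>i<d. \<Sum>j<d. \<integral>X. f i j X \<partial>ensemble)"
    if "\<And>i j. i < d \<Longrightarrow> j < d \<Longrightarrow> integrable ensemble (f i j)" for f :: "nat \<Rightarrow> nat \<Rightarrow> _ \<Rightarrow> complex"
    using that by (subst Bochner_Integration.integral_sum, force)
      (intro sum.cong refl Bochner_Integration.integral_sum, auto)
  have "of_real (real d * ?D) * of_real (real d * (1 - t * (\<integral>X. ?m X \<partial>ensemble)))
      = (\<Sum>i<d. \<Sum>j<d. of_real (real d * ?D) * (\<integral>X. \<iota> (X (i, j)) * resadj X j i \<partial>ensemble))"
    unfolding lhs[symmetric] using stein_identity_entry(1)
    by (subst int_sum) (auto simp: sum_distrib_left)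
  also have "\<dots> = (\<Sum>i<d. \<Sum>j<d. of_nat DIM('a) * (\<integral>X. res X j * (1 - sand X i) \<partial>ensemble)
        - pseudo_variance * (\<integral>X. (resadj X j i)\<^sup>2 \<partial>ensemble))"
    using stein_identity_entry(2) by (intro sum.cong refl) auto
  also have "\<dots> = of_nat DIM('a) * (\<Sum>i<d. \<Sum>j<d. \<integral>X. res X j * (1 - sand X i) \<partial>ensemble)
        - pseudo_variance * (\<Sum>i<d. \<Sum>j<d. \<integral>X. (resadj X j i)\<^sup>2 \<partial>ensemble)"
    by (simp add: sum_subtractf sum_distrib_left)
  also have "(\<Sum>i<d. \<Sum>j<d. \<integral>X. res X j * (1 - sand X i) \<partial>ensemble)
      = of_real ((real d)\<^sup>2 * t * (\<integral>X. (?m X)\<^sup>2 \<partial>ensemble))"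
    unfolding rhs[symmetric] using integrable_res_sand by (intro int_sum[symmetric]) auto
  also have "(\<Sum>i<d. \<Sum>j<d. \<integral>X. (resadj X j i)\<^sup>2 \<partial>ensemble) = ?W"
    using integrable_resadj_square by (intro int_sum[symmetric]) auto
  finally have "of_real (?D * (real d)\<^sup>2 * ((1 - t * (\<integral>X. ?m X \<partial>ensemble)) - t * (\<integral>X. (?m X)\<^sup>2 \<partial>ensemble)))
      = - (pseudo_variance * ?W)"
    by (simp add: algebra_simps power2_eq_square)
  then have "cmod (of_real (?D * (real d)\<^sup>2 * ((1 - t * (\<integral>X. ?m X \<partial>ensemble)) - t * (\<integral>X. (?m X)\<^sup>2 \<partial>ensemble))))
      = cmod pseudo_variance * cmod ?W"
    by (simp only: norm_minus_cancel norm_mult)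
  then have eq: "?D * (real d)\<^sup>2 * \<bar>(1 - t * (\<integral>X. ?m X \<partial>ensemble)) - t * (\<integral>X. (?m X)\<^sup>2 \<partial>ensemble)\<bar>
      = cmod pseudo_variance * cmod ?W"
    unfolding norm_of_real abs_mult by simp
  have "cmod (\<Sum>i<d. \<Sum>j<d. (resadj X j i)\<^sup>2) \<le> real d / (4 * t)" for X
  proof -
    have "cmod (\<Sum>i<d. \<Sum>j<d. (resadj X j i)\<^sup>2) \<le> (\<Sum>i<d. \<Sum>j<d. (cmod (resadj X j i))\<^sup>2)"
      by (intro order_trans[OF norm_sum] sum_mono order_trans[OF norm_sum]) (simp add: norm_power)
    then show ?thesis by (rule order_trans) (rule sum_norm_resadj)
  qed
  moreover have "integrable ensemble (\<lambda>X. \<Sum>i<d. \<Sum>j<d. (resadj X j i)\<^sup>2)"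
    using integrable_resadj_square by (intro Bochner_Integration.integrable_sum) auto
  ultimately have "cmod ?W \<le> (\<integral>X. real d / (4 * t) \<partial>ensemble)"
    by (intro order_trans[OF integral_norm_bound] integral_mono integrable_norm) auto
  then have "cmod ?W \<le> real d / (4 * t)" using P.prob_space by simp
  then have "?D * (real d)\<^sup>2 * \<bar>(1 - t * (\<integral>X. ?m X \<partial>ensemble)) - t * (\<integral>X. (?m X)\<^sup>2 \<partial>ensemble)\<bar>
      \<le> cmod pseudo_variance * (real d / (4 * t))"
    unfolding eq by (intro mult_left_mono) auto
  then show ?thesis
    using D d_pos t by (simp add: field_simps power2_eq_square)
qed

text \<open>The third bound is the loop equation combined with nonnegativity of the variance of m.
  The fourth uses E[m^2] <= 1 / t^2 instead and gives the decay for large t that makes the integral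
  over u finite.\<close>

lemma mean_trace_bounds:
  defines "M \<equiv> \<integral>X. normalized_trace t X \<partial>ensemble"
    and "\<epsilon> \<equiv> cmod pseudo_variance / (real DIM('a) * real d)"
  shows "0 \<le> M" "M \<le> 1 / t" "1 - t * M \<ge> t * M\<^sup>2 - \<epsilon> / (4 * t)" "1 - t * M \<le> (1 + \<epsilon> / 4) / t"
proof -
  let ?m = "normalized_trace t"
  let ?M2 = "\<integral>X. (?m X)\<^sup>2 \<partial>ensemble"
  have m2: "(?m X)\<^sup>2 \<le> (1 / t)\<^sup>2" for X
    using normalized_trace_bounds by (intro power_mono) auto
  have int_m2: "integrable ensemble (\<lambda>X. (?m X)\<^sup>2)"
    using m2 borel_measurable_normalized_trace
    by (intro P.integrable_const_bound[where B = "(1 / t)\<^sup>2"]) auto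
  show "0 \<le> M" unfolding M_def using normalized_trace_bounds by simp
  have "M \<le> (\<integral>X. 1 / t \<partial>ensemble)"
    unfolding M_def using integrable_normalized_trace normalized_trace_bounds by (intro integral_mono) auto
  then show "M \<le> 1 / t" using P.prob_space by simp
  have "?M2 \<le> (\<integral>X. (1 / t)\<^sup>2 \<partial>ensemble)"
    using int_m2 m2 by (intro integral_mono) auto
  then have "?M2 \<le> (1 / t)\<^sup>2" using P.prob_space by simp
  then have up: "t * ?M2 \<le> 1 / t"
    using mult_left_mono[of ?M2 "(1 / t)\<^sup>2" t] t by (simp add: power2_eq_square)
  have "0 \<le> P.variance ?m" by (rule P.variance_positive)
  then have "M\<^sup>2 \<le> ?M2"
    using P.variance_eq[OF integrable_normalized_trace int_m2] by (simp add: M_def)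
  then have low: "t * M\<^sup>2 \<le> t * ?M2" using t by simp
  have loop: "\<bar>1 - t * M - t * ?M2\<bar> \<le> \<epsilon> / (4 * t)"
    using loop_equation unfolding M_def \<epsilon>_def .
  show "1 - t * M \<ge> t * M\<^sup>2 - \<epsilon> / (4 * t)" using loop low by linarith
  have "1 - t * M \<le> 1 / t + \<epsilon> / (4 * t)" using loop up by linarith
  also have "\<dots> = (1 + \<epsilon> / 4) / t" by (simp add: add_divide_distrib)
  finally show "1 - t * M \<le> (1 + \<epsilon> / 4) / t" .
qed

end

end

section \<open>From the resolvent to singular values\<close>

lemma nn_integral_sqrt_kernel:
  fixes x :: real
  assumes "x \<ge> 0"
  shows "(\<integral>\<^sup>+u. ennreal (x / (x + u\<^sup>2)) * indicator {0..} u \<partial>lborel) = ennreal (pi / 2 * sqrt x)"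
proof (cases "x = 0")
  case False
  with assms have x: "x > 0" by simp
  have "(\<integral>\<^sup>+u. ennreal (x / (x + u\<^sup>2)) * indicator {0..} u \<partial>lborel)
      = ennreal (sqrt x * (pi / 2) - sqrt x * arctan (0 / sqrt x))"
  proof (rule nn_integral_FTC_atLeast[where F = "\<lambda>u. sqrt x * arctan (u / sqrt x)"])
    fix u :: real assume "0 \<le> u"
    show "((\<lambda>u. sqrt x * arctan (u / sqrt x)) has_real_derivative x / (x + u\<^sup>2)) (at u)"
      using x by (auto intro!: derivative_eq_intros simp: power_divide field_simps)
    show "0 \<le> x / (x + u\<^sup>2)" using x by simp
  next
    have "filterlim (\<lambda>u. u / sqrt x) at_top at_top"
      using x by real_asymp
    then show "((\<lambda>u. sqrt x * arctan (u / sqrt x)) \<longlongrightarrow> sqrt x * (pi / 2)) at_top"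
      by (intro tendsto_mult tendsto_const filterlim_compose[OF tendsto_arctan_at_top])
  qed measurable
  then show ?thesis by (simp add: mult.commute)
qed simp

lemma nn_integral_cauchy_kernel:
  fixes c :: real
  assumes "c \<ge> 0"
  shows "(\<integral>\<^sup>+u. ennreal (c * (1 / (1 + u\<^sup>2))) * indicator {0..} u \<partial>lborel) = ennreal (c * (pi / 2))"
proof -
  have "(\<integral>\<^sup>+u. ennreal (c * (1 / (1 + u\<^sup>2))) * indicator {0..} u \<partial>lborel)
      = (\<integral>\<^sup>+u. ennreal c * (ennreal (1 / (1 + u\<^sup>2)) * indicator {0..} u) \<partial>lborel)"
    using assms by (intro nn_integral_cong) (simp only: ennreal_mult' mult.assoc)
  also have "\<dots> = ennreal c * ennreal (pi / 2)"
    using nn_integral_sqrt_kernel[of 1] by (subst nn_integral_cmult) auto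
  also have "\<dots> = ennreal (c * (pi / 2))" by (rule ennreal_mult'[OF assms, symmetric])
  finally show ?thesis .
qed

text \<open>The integrand is 1 - p for the positive root p of p^2 + u^2 p = u^2, that is, the mean
  of s^2 / (s^2 + u^2) under the quarter-circle law on [0, 2]. The value 4 / 3 is pi / 2 times the
  mean 8 / (3 pi) of that law.\<close>

lemma nn_integral_quarter_circle_transform:
  "(\<integral>\<^sup>+u. ennreal (1 + u\<^sup>2 / 2 - u * sqrt (u\<^sup>2 + 4) / 2) * indicator {0..} u \<partial>lborel) = ennreal (4 / 3)"
proof -
  \<comment> \<open>The expansion of (u^2 + 4)^(3/2) begins u^3 + 6 u, so this antiderivative
    vanishes at infinity; at 0 it equals -8 / 6.\<close>
  let ?F = "\<lambda>u :: real. u + u ^ 3 / 6 - sqrt (u\<^sup>2 + 4) ^ 3 / 6"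
  have "(\<integral>\<^sup>+u. ennreal (1 + u\<^sup>2 / 2 - u * sqrt (u\<^sup>2 + 4) / 2) * indicator {0..} u \<partial>lborel) = ennreal (0 - ?F 0)"
  proof (rule nn_integral_FTC_atLeast[where F = ?F])
    fix u :: real assume "0 \<le> u"
    have pos: "u\<^sup>2 + 4 > 0" by (simp add: add_nonneg_pos)
    then have s: "sqrt (u\<^sup>2 + 4) > 0" by simp
    have s2: "sqrt (u * u + 4) * (sqrt (u * u + 4) * c) = (u * u + 4) * c" for c
      by (simp add: mult.assoc[symmetric])
    show "(?F has_real_derivative 1 + u\<^sup>2 / 2 - u * sqrt (u\<^sup>2 + 4) / 2) (at u)"
      using pos s by (auto intro!: derivative_eq_intros simp: field_simps power2_eq_square s2)
    have "(u * sqrt (u\<^sup>2 + 4))\<^sup>2 = u\<^sup>2 * (u\<^sup>2 + 4)" by (simp add: power_mult_distrib)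
    also have "\<dots> \<le> u\<^sup>2 * (u\<^sup>2 + 4) + 4" by simp
    also have "\<dots> = (u\<^sup>2 + 2)\<^sup>2" by (simp add: algebra_simps power2_eq_square)
    finally have "u * sqrt (u\<^sup>2 + 4) \<le> u\<^sup>2 + 2" by (rule power2_le_imp_le) simp
    then show "0 \<le> 1 + u\<^sup>2 / 2 - u * sqrt (u\<^sup>2 + 4) / 2" by simp
  next
    show "(?F \<longlongrightarrow> 0) at_top" by real_asymp
  qed measurable
  also have "sqrt 4 = (2 :: real)" by (simp add: real_sqrt_unique)
  then have "0 - ?F 0 = 4 / 3" by simp
  finally show ?thesis by simp
qed

text \<open>If the claim failed, completing the square would give w \<eta> + \<eta>^2 < \<epsilon> /
  4, with w = u sqrt (u^2 + 4) and \<eta> the permitted error. The profile 1 / (1 + u^2) of \<eta>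
  is integrable and still large enough to exclude this for every u.\<close>

lemma quadratic_root_bound:
  fixes u p \<epsilon> :: real
  assumes u: "u > 0" and p: "p\<^sup>2 + u\<^sup>2 * p \<le> u\<^sup>2 + \<epsilon> / 4" and \<epsilon>: "0 \<le> \<epsilon>" "\<epsilon> \<le> 1"
  shows "1 + u\<^sup>2 / 2 - u * sqrt (u\<^sup>2 + 4) / 2 \<le> (1 - p) + sqrt \<epsilon> * (1 / (1 + u\<^sup>2))"
proof (rule ccontr)
  assume *: "\<not> ?thesis"
  define w where "w = u * sqrt (u\<^sup>2 + 4)"
  define \<eta> where "\<eta> = sqrt \<epsilon> * (1 / (1 + u\<^sup>2))"
  have "sqrt (u\<^sup>2 + 4) \<ge> u" using u by (intro real_le_rsqrt) auto
  then have w: "w \<ge> u\<^sup>2" using u by (simp add: w_def power2_eq_square)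
  have w2: "w\<^sup>2 = u\<^sup>2 * (u\<^sup>2 + 4)" by (simp add: w_def power_mult_distrib)
  have \<eta>: "\<eta> \<ge> 0" using \<epsilon> by (simp add: \<eta>_def)
  have "2 * p + u\<^sup>2 > w + 2 * \<eta>" using * by (simp add: w_def \<eta>_def)
  then have "(2 * p + u\<^sup>2)\<^sup>2 > (w + 2 * \<eta>)\<^sup>2"
    using w \<eta> zero_le_power2[of u] by (intro power_strict_mono) linarith+
  then have "4 * p\<^sup>2 + 4 * (u\<^sup>2 * p) > 4 * u\<^sup>2 + 4 * (w * \<eta>) + 4 * \<eta>\<^sup>2"
    using w2 by (simp add: power2_eq_square algebra_simps)
  with p have lt: "\<epsilon> / 4 > w * \<eta> + \<eta>\<^sup>2" by simp
  have wn: "w * \<eta> \<ge> u\<^sup>2 * \<eta>" using w \<eta> by (rule mult_right_mono)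
  \<comment> \<open>For u <= 1 one has \<eta> >= sqrt \<epsilon> / 2, and \<eta>^2 alone is too
    large. For u > 1 the product is too large: w \<eta> >= u^2 \<eta> >= sqrt \<epsilon> / 2 >=
    \<epsilon> / 2, the last step by \<epsilon> <= 1.\<close>
  show False
  proof (cases "u \<le> 1")
    case True
    then have "u\<^sup>2 \<le> 1" using u by (simp add: power_le_one)
    then have "1 / 2 \<le> 1 / (1 + u\<^sup>2)" using u by (intro divide_left_mono) (auto simp: add_pos_nonneg)
    then have "sqrt \<epsilon> * (1 / 2) \<le> \<eta>" unfolding \<eta>_def using \<epsilon> by (intro mult_left_mono) auto
    then have "(sqrt \<epsilon> * (1 / 2))\<^sup>2 \<le> \<eta>\<^sup>2" using \<epsilon> by (intro power_mono) auto
    then have "\<epsilon> / 4 \<le> \<eta>\<^sup>2" using \<epsilon> by (simp add: power_mult_distrib power2_eq_square)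
    moreover have "w * \<eta> \<ge> 0" using u \<eta> by (simp add: w_def)
    ultimately show False using lt by linarith
  next
    case False
    then have "u\<^sup>2 \<ge> 1" by simp
    then have "1 / 2 \<le> u\<^sup>2 * (1 / (1 + u\<^sup>2))" by (simp add: pos_le_divide_eq)
    then have "sqrt \<epsilon> * (1 / 2) \<le> sqrt \<epsilon> * (u\<^sup>2 * (1 / (1 + u\<^sup>2)))"
      using \<epsilon> by (intro mult_left_mono) auto
    then have "sqrt \<epsilon> / 2 \<le> u\<^sup>2 * \<eta>" by (simp add: \<eta>_def mult_ac)
    moreover have "\<epsilon> \<le> sqrt \<epsilon>"
      using \<epsilon> by (intro real_le_rsqrt) (simp add: power2_eq_square mult_left_le)
    ultimately show False using lt wn \<epsilon> zero_le_power2[of \<eta>] by linarith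
  qed
qed

lemma Re_sum_mset: "Re (\<Sum>x\<in>#M. f x) = (\<Sum>x\<in>#M. Re (f x))"
  by (induction M) auto

lemma sum_mset_one_minus:
  fixes c :: real
  shows "(\<Sum>x\<in>#M. 1 - c * f x) = real (size M) - c * (\<Sum>x\<in>#M. f x)"
  by (induction M) (auto simp: algebra_simps)

lemma sum_mset_image_nonneg:
  fixes f :: "'a \<Rightarrow> real"
  shows "(\<And>x. x \<in># M \<Longrightarrow> 0 \<le> f x) \<Longrightarrow> 0 \<le> (\<Sum>x\<in>#M. f x)"
  by (induction M) auto

lemma sum_mset_ennreal:
  "(\<And>x. x \<in># M \<Longrightarrow> 0 \<le> f x) \<Longrightarrow> (\<Sum>x\<in>#M. ennreal (f x)) = ennreal (\<Sum>x\<in>#M. f x)"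
  by (induction M) (auto simp: ennreal_plus sum_mset_image_nonneg)

lemma nn_integral_sum_mset:
  fixes f :: "'b \<Rightarrow> 'c \<Rightarrow> real"
  assumes "\<And>e. f e \<in> borel_measurable M" "\<And>e x. e \<in># E \<Longrightarrow> f e x \<ge> 0"
  shows "(\<integral>\<^sup>+x. ennreal (\<Sum>e\<in>#E. f e x) \<partial>M) = (\<Sum>e\<in>#E. \<integral>\<^sup>+x. ennreal (f e x) \<partial>M)"
  using assms(2)
proof (induction E)
  case (add a E)
  have "(\<Sum>e\<in>#E. f e x) \<ge> 0" for x using add.prems by (intro sum_mset_image_nonneg) auto
  moreover have "(\<lambda>x. \<Sum>e\<in>#E. f e x) \<in> borel_measurable M"
    by (induction E) (auto intro!: borel_measurable_add assms)
  ultimately show ?case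
    using add assms(1) by (simp add: ennreal_plus nn_integral_add)
qed simp

section \<open>Expected mean singular value of an ensemble\<close>

context ginibre_ensemble
begin

text \<open>The error parameter \<epsilon> of \<open>mean_trace_bounds\<close>: 1 / d for real and 0
  for complex entries.\<close>

definition pseudo_ratio :: real where
  "pseudo_ratio = cmod pseudo_variance / (real DIM('a) * real d)"

lemma pseudo_ratio_bounds: "0 \<le> pseudo_ratio" "pseudo_ratio \<le> 1"
proof -
  show "0 \<le> pseudo_ratio" by (simp add: pseudo_ratio_def)
  have "cmod pseudo_variance \<le> (\<Sum>b\<in>(Basis :: 'a set). cmod ((\<iota> b)\<^sup>2))"
    unfolding pseudo_variance_def by (rule norm_sum)
  also have "\<dots> = (\<Sum>b\<in>(Basis :: 'a set). 1)"
    by (intro sum.cong) (auto simp: norm_power norm_\<iota>)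
  also have "\<dots> \<le> real DIM('a) * real d"
    using d_pos by simp
  finally show "pseudo_ratio \<le> 1"
    using d_pos by (simp add: pseudo_ratio_def divide_le_eq_1)
qed

definition mean_trace :: "real \<Rightarrow> real" where
  "mean_trace t = (\<integral>X. normalized_trace t X \<partial>ensemble)"

text \<open>With p = u^2 M(u^2), multiplying the third bound of \<open>mean_trace_bounds\<close> by
  t = u^2 clears the denominators and produces the quadratic inequality in p.\<close>

lemma mean_trace_lower:
  assumes u: "u > 0"
  shows "1 + u\<^sup>2 / 2 - u * sqrt (u\<^sup>2 + 4) / 2
    \<le> (1 - u\<^sup>2 * mean_trace (u\<^sup>2)) + sqrt pseudo_ratio * (1 / (1 + u\<^sup>2))"
proof (rule quadratic_root_bound[OF u _ pseudo_ratio_bounds])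
  let ?t = "u\<^sup>2" and ?M = "mean_trace (u\<^sup>2)"
  have t: "?t > 0" using u by simp
  have "?t * ?M\<^sup>2 - pseudo_ratio / (4 * ?t) \<le> 1 - ?t * ?M"
    using mean_trace_bounds(3)[OF t] by (simp add: mean_trace_def pseudo_ratio_def)
  then have "?t * (?t * ?M\<^sup>2 - pseudo_ratio / (4 * ?t)) \<le> ?t * (1 - ?t * ?M)"
    using t by (intro mult_left_mono) auto
  moreover have "?t * (?t * ?M\<^sup>2 - pseudo_ratio / (4 * ?t)) = (?t * ?M)\<^sup>2 - pseudo_ratio / 4"
    using t by (simp add: right_diff_distrib power_mult_distrib)
  moreover have "?t * (1 - ?t * ?M) = ?t - ?t * (?t * ?M)"
    by (simp add: right_diff_distrib)
  ultimately show "(?t * ?M)\<^sup>2 + ?t * (?t * ?M) \<le> ?t + pseudo_ratio / 4"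
    by linarith
qed

text \<open>Serves to prove the integral over u finite, so the constant is generous: 1 - t M is at
  most 1, and t times it is at most 5 / 4, rounded up to 3 / 2.\<close>

lemma mean_trace_upper:
  assumes u: "u > 0"
  shows "1 - u\<^sup>2 * mean_trace (u\<^sup>2) \<le> 3 * (1 / (1 + u\<^sup>2))"
proof -
  let ?t = "u\<^sup>2" and ?M = "mean_trace (u\<^sup>2)"
  have t: "?t > 0" using u by simp
  have "1 - ?t * ?M \<le> (1 + pseudo_ratio / 4) / ?t"
    using mean_trace_bounds(4)[OF t] by (simp add: mean_trace_def pseudo_ratio_def)
  also have "\<dots> \<le> (3 / 2) / ?t"
    using pseudo_ratio_bounds t by (intro divide_right_mono) auto
  finally have 1: "(1 - ?t * ?M) * ?t \<le> 3 / 2" using t by (simp add: field_simps)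
  have 2: "1 - ?t * ?M \<le> 1"
    using mean_trace_bounds(1)[OF t] t by (simp add: mean_trace_def)
  from 1 2 have "(1 - ?t * ?M) * (1 + ?t) \<le> 3"
    by (simp add: distrib_left)
  moreover have "1 + ?t > 0" using t by linarith
  ultimately show ?thesis by (simp add: pos_le_divide_eq)
qed

lemma borel_measurable_joint_normalized_trace:
  "(\<lambda>(u, X). normalized_trace (u\<^sup>2) X) \<in> borel_measurable (lborel \<Otimes>\<^sub>M ensemble)"
proof -
  have "(\<lambda>p. resolvent ((fst p)\<^sup>2) (ensemble_mat (snd p)) $$ (j, j)) \<in> borel_measurable (lborel \<Otimes>\<^sub>M ensemble)"
    if j: "j < d" for j
  proof (rule borel_measurable_resolvent[where n = d])
    fix k l assume kl: "k < d" "l < d"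
    have "(\<lambda>p. \<iota> (snd p (k, l))) \<in> borel_measurable (lborel \<Otimes>\<^sub>M ensemble)"
      by (rule measurable_compose[OF measurable_snd borel_measurable_ensemble_mat[OF kl]])
    then show "(\<lambda>p. ensemble_mat (snd p) $$ (k, l)) \<in> borel_measurable (lborel \<Otimes>\<^sub>M ensemble)"
      using kl by simp
  qed (use j in auto)
  then have "(\<lambda>p. normalized_trace ((fst p)\<^sup>2) (snd p)) \<in> borel_measurable (lborel \<Otimes>\<^sub>M ensemble)"
    unfolding normalized_trace_def
    by (intro borel_measurable_divide borel_measurable_sum borel_measurable_const
        measurable_compose[OF _ borel_measurable_Re]) simp_all
  then show ?thesis by (simp add: case_prod_unfold)
qed

text \<open>Sum e / (e + t) = 1 - t / (e + t) over the d eigenvalues. They are real and nonnegative,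
  so real parts pass through the reciprocals and no denominator vanishes.\<close>

lemma one_minus_normalized_trace:
  assumes u: "u > 0"
  shows "1 - u\<^sup>2 * normalized_trace (u\<^sup>2) X
    = (\<Sum>e\<in>#proots (char_poly (mat_adjoint (ensemble_mat X) * ensemble_mat X)).
        Re e / (Re e + u\<^sup>2)) / real d"
proof -
  let ?E = "proots (char_poly (mat_adjoint (ensemble_mat X) * ensemble_mat X))"
  have t: "u\<^sup>2 > 0" using u by simp
  note tr = trace_resolvent[OF ensemble_mat_carrier t, of X]
  have "real d * normalized_trace (u\<^sup>2) X = Re (\<Sum>j<d. resolvent (u\<^sup>2) (ensemble_mat X) $$ (j, j))"
    unfolding sum_res[OF t] by simp
  also have "\<dots> = Re (\<Sum>e\<in>#?E. 1 / (e + of_real (u\<^sup>2)))"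
    unfolding tr(1) ..
  also have "\<dots> = (\<Sum>e\<in>#?E. Re (1 / (e + of_real (u\<^sup>2))))"
    by (rule Re_sum_mset)
  also have "\<dots> = (\<Sum>e\<in>#?E. 1 / (Re e + u\<^sup>2))"
  proof (rule arg_cong[where f = sum_mset], rule image_mset_cong)
    fix e assume "e \<in># ?E"
    then have "e \<in> \<real>" by (rule gram_roots(1)[OF ensemble_mat_carrier])
    then obtain r where "e = of_real r" by (rule Reals_cases)
    then have "1 / (e + of_real (u\<^sup>2)) = of_real (1 / (r + u\<^sup>2))" "Re e = r" by auto
    then show "Re (1 / (e + of_real (u\<^sup>2))) = 1 / (Re e + u\<^sup>2)" by (simp only: Re_complex_of_real)
  qed
  finally have trace: "(\<Sum>e\<in>#?E. 1 / (Re e + u\<^sup>2)) = real d * normalized_trace (u\<^sup>2) X" ..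
  have "(\<Sum>e\<in>#?E. Re e / (Re e + u\<^sup>2)) = (\<Sum>e\<in>#?E. 1 - u\<^sup>2 * (1 / (Re e + u\<^sup>2)))"
  proof (rule arg_cong[where f = sum_mset], rule image_mset_cong)
    fix e assume "e \<in># ?E"
    then have "Re e \<ge> 0" by (rule gram_roots(2)[OF ensemble_mat_carrier])
    then have "Re e + u\<^sup>2 > 0" using t by linarith
    then show "Re e / (Re e + u\<^sup>2) = 1 - u\<^sup>2 * (1 / (Re e + u\<^sup>2))" by (simp add: field_simps)
  qed
  also have "\<dots> = real (size ?E) - u\<^sup>2 * (\<Sum>e\<in>#?E. 1 / (Re e + u\<^sup>2))"
    by (rule sum_mset_one_minus)
  also have "\<dots> = real d * (1 - u\<^sup>2 * normalized_trace (u\<^sup>2) X)"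
    unfolding tr(2) trace by (simp add: algebra_simps)
  finally show ?thesis using d_pos by simp
qed

definition mean_singular_value :: "(nat \<times> nat \<Rightarrow> 'a) \<Rightarrow> real" where
  "mean_singular_value X = sum_singular_values (ensemble_mat X) / real d"

lemma mean_singular_value_nonneg: "mean_singular_value X \<ge> 0"
proof -
  have "sum_singular_values (ensemble_mat X) \<ge> 0"
    unfolding sum_singular_values_def singular_values_def
    using gram_roots(2)[OF ensemble_mat_carrier, of _ X] by (auto intro!: sum_mset_image_nonneg)
  then show ?thesis by (simp add: mean_singular_value_def)
qed

lemma mean_singular_value_integral:
  "ennreal (pi / 2 * mean_singular_value X)
    = (\<integral>\<^sup>+u. ennreal (1 - u\<^sup>2 * normalized_trace (u\<^sup>2) X) * indicator {0..} u \<partial>lborel)"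
proof -
  let ?E = "proots (char_poly (mat_adjoint (ensemble_mat X) * ensemble_mat X))"
  let ?f = "\<lambda>e u. indicator {0..} (u :: real) / real d * (Re e / (Re e + u\<^sup>2))"
  have pos: "Re e \<ge> 0" if "e \<in># ?E" for e
    using that by (rule gram_roots(2)[OF ensemble_mat_carrier])
  have "(\<integral>\<^sup>+u. ennreal (1 - u\<^sup>2 * normalized_trace (u\<^sup>2) X) * indicator {0..} u \<partial>lborel)
      = (\<integral>\<^sup>+u. ennreal (\<Sum>e\<in>#?E. ?f e u) \<partial>lborel)"
  proof (rule nn_integral_cong_AE)
    \<comment> \<open>At u = 0 the Gram matrix may be singular, and \<open>resolvent\<close> is then
      not its inverse; this single point is a null set.\<close>
    have "AE u in lborel. u \<noteq> (0 :: real)" by (rule AE_lborel_singleton)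
    then show "AE u in lborel. ennreal (1 - u\<^sup>2 * normalized_trace (u\<^sup>2) X) * indicator {0..} u
        = ennreal (\<Sum>e\<in>#?E. ?f e u)"
    proof eventually_elim
      case (elim u)
      show ?case
      proof (cases "u > 0")
        case True
        define S where "S = (\<Sum>e\<in>#?E. Re e / (Re e + u\<^sup>2))"
        have F: "(\<Sum>e\<in>#?E. ?f e u) = indicator {0..} u / real d * S"
          by (simp only: S_def sum_mset_distrib_left)
        show ?thesis
          unfolding F one_minus_normalized_trace[OF True] S_def[symmetric] using True by simp
      next
        case False
        then show ?thesis using elim by simp
      qed
    qed
  qed
  also have "\<dots> = (\<Sum>e\<in>#?E. \<integral>\<^sup>+u. ennreal (?f e u) \<partial>lborel)"
    using pos by (intro nn_integral_sum_mset) auto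
  also have "\<dots> = (\<Sum>e\<in>#?E. ennreal (pi / 2 * sqrt (Re e) / real d))"
  proof (rule arg_cong[where f = sum_mset], rule image_mset_cong)
    fix e assume e: "e \<in># ?E"
    have "(\<integral>\<^sup>+u. ennreal (?f e u) \<partial>lborel)
        = (\<integral>\<^sup>+u. ennreal (1 / real d) * (ennreal (Re e / (Re e + u\<^sup>2)) * indicator {0..} u) \<partial>lborel)"
      using pos[OF e] by (intro nn_integral_cong) (auto simp: indicator_def ennreal_mult[symmetric])
    also have "\<dots> = ennreal (1 / real d) * ennreal (pi / 2 * sqrt (Re e))"
      by (subst nn_integral_cmult) (auto simp: nn_integral_sqrt_kernel[OF pos[OF e]])
    also have "\<dots> = ennreal (pi / 2 * sqrt (Re e) / real d)"
      using pos[OF e] by (simp add: ennreal_mult[symmetric])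
    finally show "(\<integral>\<^sup>+u. ennreal (?f e u) \<partial>lborel) = ennreal (pi / 2 * sqrt (Re e) / real d)" .
  qed
  also have "\<dots> = ennreal (\<Sum>e\<in>#?E. pi / 2 * sqrt (Re e) / real d)"
    using pos by (intro sum_mset_ennreal) simp
  also have "(\<Sum>e\<in>#?E. pi / 2 * sqrt (Re e) / real d) = pi / 2 * mean_singular_value X"
  proof -
    have "(\<Sum>e\<in>#?E. pi / 2 * sqrt (Re e) / real d) = (\<Sum>e\<in>#?E. pi / 2 / real d * sqrt (Re e))"
      by simp
    also have "\<dots> = pi / 2 / real d * sum_singular_values (ensemble_mat X)"
      by (simp only: sum_mset_distrib_left sum_singular_values_def singular_values_def)
    finally show ?thesis
      by (simp add: mean_singular_value_def)
  qed
  finally show ?thesis ..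
qed

lemma borel_measurable_joint_integrand:
  "(\<lambda>(u, X). ennreal (1 - u\<^sup>2 * normalized_trace (u\<^sup>2) X) * indicator {0..} u)
    \<in> borel_measurable (lborel \<Otimes>\<^sub>M ensemble)"
proof -
  note [measurable] = borel_measurable_joint_normalized_trace[unfolded case_prod_unfold]
  show ?thesis unfolding case_prod_unfold by measurable
qed

text \<open>Tonelli exchanges expectation and u-integral before any integrability of the singular
  values is known. As t m <= 1, the inner integral is the ordinary expectation of 1 - t m.\<close>

lemma nn_integral_mean_singular_value:
  "(\<integral>\<^sup>+X. ennreal (pi / 2 * mean_singular_value X) \<partial>ensemble)
    = (\<integral>\<^sup>+u. ennreal (1 - u\<^sup>2 * mean_trace (u\<^sup>2)) * indicator {0..} u \<partial>lborel)"
proof -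
  interpret L: pair_sigma_finite lborel ensemble ..
  have "(\<integral>\<^sup>+X. ennreal (pi / 2 * mean_singular_value X) \<partial>ensemble)
      = (\<integral>\<^sup>+u. (\<integral>\<^sup>+X. ennreal (1 - u\<^sup>2 * normalized_trace (u\<^sup>2) X) * indicator {0..} u \<partial>ensemble) \<partial>lborel)"
    unfolding mean_singular_value_integral by (rule L.Fubini'[OF borel_measurable_joint_integrand])
  also have "\<dots> = (\<integral>\<^sup>+u. ennreal (1 - u\<^sup>2 * mean_trace (u\<^sup>2)) * indicator {0..} u \<partial>lborel)"
  proof (rule nn_integral_cong_AE)
    have "AE u in lborel. u \<noteq> (0 :: real)" by (rule AE_lborel_singleton)
    then show "AE u in lborel. (\<integral>\<^sup>+X. ennreal (1 - u\<^sup>2 * normalized_trace (u\<^sup>2) X) * indicator {0..} u \<partial>ensemble)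
        = ennreal (1 - u\<^sup>2 * mean_trace (u\<^sup>2)) * indicator {0..} u"
    proof eventually_elim
      case (elim u)
      show ?case
      proof (cases "u > 0")
        case True
        then have t: "u\<^sup>2 > 0" by simp
        have "1 - u\<^sup>2 * normalized_trace (u\<^sup>2) X \<ge> 0" for X
          using normalized_trace_bounds(2)[OF t, of X] t by (simp add: field_simps)
        then have "(\<integral>\<^sup>+X. ennreal (1 - u\<^sup>2 * normalized_trace (u\<^sup>2) X) \<partial>ensemble)
            = ennreal (\<integral>X. 1 - u\<^sup>2 * normalized_trace (u\<^sup>2) X \<partial>ensemble)"
          using integrable_normalized_trace[OF t] by (intro nn_integral_eq_integral) auto
        also have "(\<integral>X. 1 - u\<^sup>2 * normalized_trace (u\<^sup>2) X \<partial>ensemble) = 1 - u\<^sup>2 * mean_trace (u\<^sup>2)"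
          using integrable_normalized_trace[OF t] P.prob_space by (simp add: mean_trace_def)
        finally show ?thesis using True by simp
      next
        case False
        then show ?thesis using elim by simp
      qed
    qed
  qed
  finally show ?thesis .
qed

theorem expected_mean_singular_value_ge:
  "(\<integral>X. mean_singular_value X \<partial>ensemble) \<ge> 8 / (3 * pi) - sqrt pseudo_ratio"
proof -
  let ?S = mean_singular_value
  let ?I = "\<integral>\<^sup>+u. ennreal (1 - u\<^sup>2 * mean_trace (u\<^sup>2)) * indicator {0..} u \<partial>lborel"
  have AE0: "AE u in lborel. u \<noteq> (0 :: real)" by (rule AE_lborel_singleton)
  \<comment> \<open>The characteristic roots are not given explicitly by the entries, so
    measurability of the mean singular value is drawn from its integral representation.\<close>
  have "(\<lambda>X. ennreal (pi / 2 * ?S X)) \<in> borel_measurable ensemble"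
  proof -
    have "(\<lambda>(X, u). ennreal (1 - u\<^sup>2 * normalized_trace (u\<^sup>2) X) * indicator {0..} u)
        \<in> borel_measurable (ensemble \<Otimes>\<^sub>M lborel)"
      using measurable_pair_swap[OF borel_measurable_joint_integrand] by (simp add: case_prod_unfold)
    then show ?thesis unfolding mean_singular_value_integral
      by (rule lborel.borel_measurable_nn_integral)
  qed
  then have "(\<lambda>X. 2 / pi * enn2real (ennreal (pi / 2 * ?S X))) \<in> borel_measurable ensemble"
    by measurable
  then have meas: "?S \<in> borel_measurable ensemble"
    using mean_singular_value_nonneg by simp
  \<comment> \<open>Finiteness must be secured first: the expectation is a Bochner integral, with
    default value 0 on functions that are not integrable.\<close>
  have "?I \<le> (\<integral>\<^sup>+u. ennreal (3 * (1 / (1 + u\<^sup>2))) * indicator {0..} u \<partial>lborel)"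
  proof (rule nn_integral_mono_AE, use AE0 in eventually_elim)
    case (elim u)
    then show ?case
      using mean_trace_upper[of u] by (cases "u > 0") (auto intro!: ennreal_leI)
  qed
  also have "\<dots> < \<infinity>" by (subst nn_integral_cauchy_kernel) auto
  finally have fin: "?I < \<infinity>" .
  have int: "integrable ensemble (\<lambda>X. pi / 2 * ?S X)"
  proof (rule integrableI_nonneg)
    show "(\<integral>\<^sup>+X. ennreal (pi / 2 * ?S X) \<partial>ensemble) < \<infinity>"
      unfolding nn_integral_mean_singular_value by (rule fin)
  qed (use meas mean_singular_value_nonneg in auto)
  have "ennreal (\<integral>X. pi / 2 * ?S X \<partial>ensemble) = ?I"
    unfolding nn_integral_mean_singular_value[symmetric]
    using mean_singular_value_nonneg by (intro nn_integral_eq_integral[OF int, symmetric]) simp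
  then have I: "?I = ennreal (pi / 2 * (\<integral>X. ?S X \<partial>ensemble))" by simp
  have M_nonneg: "1 - u\<^sup>2 * mean_trace (u\<^sup>2) \<ge> 0" if "u > 0" for u
    using mean_trace_bounds(2)[of "u\<^sup>2"] that by (simp add: mean_trace_def field_simps)
  have meas_I: "(\<lambda>u. ennreal (1 - u\<^sup>2 * mean_trace (u\<^sup>2)) * indicator {0..} u) \<in> borel_measurable lborel"
  proof -
    have "(\<lambda>u. mean_trace (u\<^sup>2)) \<in> borel_measurable lborel"
      unfolding mean_trace_def
      by (rule P.borel_measurable_lebesgue_integral[OF borel_measurable_joint_normalized_trace])
    then show ?thesis by measurable
  qed
  have "ennreal (4 / 3)
      = (\<integral>\<^sup>+u. ennreal (1 + u\<^sup>2 / 2 - u * sqrt (u\<^sup>2 + 4) / 2) * indicator {0..} u \<partial>lborel)"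
    by (rule nn_integral_quarter_circle_transform[symmetric])
  also have "\<dots> \<le> (\<integral>\<^sup>+u. ennreal (1 - u\<^sup>2 * mean_trace (u\<^sup>2)) * indicator {0..} u
      + ennreal (sqrt pseudo_ratio * (1 / (1 + u\<^sup>2))) * indicator {0..} u \<partial>lborel)"
  proof (rule nn_integral_mono_AE, use AE0 in eventually_elim)
    case (elim u)
    show ?case
    proof (cases "u > 0")
      case True
      have "ennreal (1 + u\<^sup>2 / 2 - u * sqrt (u\<^sup>2 + 4) / 2)
          \<le> ennreal ((1 - u\<^sup>2 * mean_trace (u\<^sup>2)) + sqrt pseudo_ratio * (1 / (1 + u\<^sup>2)))"
        by (intro ennreal_leI mean_trace_lower True)
      also have "\<dots> = ennreal (1 - u\<^sup>2 * mean_trace (u\<^sup>2)) + ennreal (sqrt pseudo_ratio * (1 / (1 + u\<^sup>2)))"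
        using M_nonneg[OF True] pseudo_ratio_bounds by (intro ennreal_plus) auto
      finally show ?thesis using True by simp
    next
      case False
      then show ?thesis using elim by simp
    qed
  qed
  also have "\<dots> = ?I + (\<integral>\<^sup>+u. ennreal (sqrt pseudo_ratio * (1 / (1 + u\<^sup>2))) * indicator {0..} u \<partial>lborel)"
    by (rule nn_integral_add[OF meas_I]) measurable
  also have "\<dots> = ennreal (pi / 2 * (\<integral>X. ?S X \<partial>ensemble)) + ennreal (sqrt pseudo_ratio * (pi / 2))"
    unfolding I using pseudo_ratio_bounds by (subst nn_integral_cauchy_kernel) auto
  also have "\<dots> = ennreal (pi / 2 * (\<integral>X. ?S X \<partial>ensemble) + sqrt pseudo_ratio * (pi / 2))"
    using pseudo_ratio_bounds mean_singular_value_nonneg by (intro ennreal_plus[symmetric]) auto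
  finally have "4 / 3 \<le> pi / 2 * (\<integral>X. ?S X \<partial>ensemble) + sqrt pseudo_ratio * (pi / 2)"
    using pseudo_ratio_bounds mean_singular_value_nonneg by (subst (asm) ennreal_le_iff) auto
  then have "8 / 3 \<le> pi * ((\<integral>X. ?S X \<partial>ensemble) + sqrt pseudo_ratio)"
    by (simp add: algebra_simps)
  then have "8 / 3 / pi \<le> (\<integral>X. ?S X \<partial>ensemble) + sqrt pseudo_ratio"
    by (simp add: pos_divide_le_eq mult.commute)
  then show ?thesis by (simp add: field_simps)
qed

end

section \<open>The complex and the real ensemble\<close>

lemma prob_space_gaussian_complex:
  assumes d: "d > 0"
  shows "prob_space (complex_gauss d)"
proof (rule prob_spaceI)
  \<comment> \<open>Real and imaginary part each have variance 1 / (2 d), half of E |z|^2. The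
    density is then a product of two normal densities, integrated coordinate by coordinate.\<close>
  let ?\<sigma> = "1 / sqrt (2 * real d)"
  have \<sigma>: "?\<sigma> > 0" using d by simp
  have dens: "normal_density 0 ?\<sigma> x = sqrt (real d / pi) * exp (- real d * x\<^sup>2)" for x
    using d by (simp add: normal_density_def power_divide real_sqrt_divide field_simps)
  have split: "ennreal (real d / pi * exp (- real d * (cmod z)\<^sup>2))
      = (\<Prod>b\<in>Basis. ennreal (normal_density 0 ?\<sigma> (inner z b)))" for z
  proof -
    have "(\<Prod>b\<in>(Basis :: complex set). ennreal (normal_density 0 ?\<sigma> (inner z b)))
        = ennreal (normal_density 0 ?\<sigma> (Re z)) * ennreal (normal_density 0 ?\<sigma> (Im z))"
      by (simp add: Basis_complex_def inner_complex_def complex_eq_iff)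
    also have "\<dots> = ennreal (normal_density 0 ?\<sigma> (Re z) * normal_density 0 ?\<sigma> (Im z))"
      by (simp add: ennreal_mult)
    also have "normal_density 0 ?\<sigma> (Re z) * normal_density 0 ?\<sigma> (Im z)
        = (sqrt (real d / pi) * sqrt (real d / pi)) * (exp (- real d * (Re z)\<^sup>2) * exp (- real d * (Im z)\<^sup>2))"
      unfolding dens by (simp only: mult_ac)
    also have "\<dots> = real d / pi * exp (- real d * (cmod z)\<^sup>2)"
      by (simp add: exp_add[symmetric] cmod_power2 algebra_simps)
    finally show ?thesis ..
  qed
  have one: "(\<integral>\<^sup>+x. ennreal (normal_density 0 ?\<sigma> x) \<partial>lborel) = 1"
  proof -
    interpret N: prob_space "density lborel (normal_density 0 ?\<sigma>)"
      by (rule prob_space_normal_density[OF \<sigma>])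
    show ?thesis using N.emeasure_space_1 by (simp add: emeasure_density)
  qed
  have "emeasure (complex_gauss d) (space (complex_gauss d))
      = (\<integral>\<^sup>+(z :: complex). (\<Prod>b\<in>Basis. ennreal (normal_density 0 ?\<sigma> (inner z b))) \<partial>lborel)"
    unfolding complex_gauss_def split by (subst emeasure_density) auto
  also have "\<dots> = (\<Prod>b\<in>(Basis :: complex set). \<integral>\<^sup>+x. ennreal (normal_density 0 ?\<sigma> x) \<partial>lborel)"
    by (rule nn_integral_lborel_prod) auto
  finally show "emeasure (complex_gauss d) (space (complex_gauss d)) = 1"
    by (simp add: one)
qed

lemma ginibre_ensemble_complex:
  assumes d: "d > 0"
  shows "ginibre_ensemble (complex_gauss d) (real d / pi) d (\<lambda>z. z)"
proof (rule ginibre_ensemble.intro)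
  show "complex_gauss d = gaussian (real d / pi) (real d * real DIM(complex))"
    by (simp add: complex_gauss_def gaussian_def)
  show "prob_space (complex_gauss d)" by (rule prob_space_gaussian_complex[OF d])
qed (use d in \<open>auto simp: linear_id[unfolded id_def]\<close>)

lemma ginibre_ensemble_real:
  assumes d: "d > 0"
  shows "ginibre_ensemble (real_gauss d) (sqrt (real d / (2 * pi))) d complex_of_real"
proof (rule ginibre_ensemble.intro)
  show "real_gauss d = gaussian (sqrt (real d / (2 * pi))) (real d * real DIM(real))"
    unfolding real_gauss_def gaussian_def normal_density_def
    using d by (simp add: real_sqrt_divide field_simps)
  show "prob_space (real_gauss d)"
    unfolding real_gauss_def using d by (intro prob_space_normal_density) simp
  show "linear complex_of_real"
    using bounded_linear_of_real by (rule bounded_linear.linear)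
qed (use d in auto)

theorem theorem3:
  fixes d :: nat
  assumes "d \<ge> 1"
  shows "alpha_C d \<ge> 8 / (3 * pi) - 4 / real d
     \<and> alpha_R d \<ge> 8 / (3 * pi) - 3 * sqrt (1 / real d) - 4 / real d"
proof
  have d: "d > 0" using assms by simp
  interpret C: ginibre_ensemble "complex_gauss d" "real d / pi" d "\<lambda>z. z"
    by (rule ginibre_ensemble_complex[OF d])
  interpret R: ginibre_ensemble "real_gauss d" "sqrt (real d / (2 * pi))" d complex_of_real
    by (rule ginibre_ensemble_real[OF d])
  have "C.mean_singular_value = (\<lambda>G. sum_singular_values (complex_matrix_of d G) / real d)"
    by (simp add: fun_eq_iff C.mean_singular_value_def C.ensemble_mat_def complex_matrix_of_def)
  then have "alpha_C d = (\<integral>G. C.mean_singular_value G \<partial>C.ensemble)"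
    by (simp add: alpha_C_def complex_ginibre_def)
  \<comment> \<open>The basis consists of 1 and i, whose squares cancel.\<close>
  moreover have "C.pseudo_ratio = 0"
    by (simp add: C.pseudo_ratio_def C.pseudo_variance_def Basis_complex_def complex_eq_iff)
  ultimately have "alpha_C d \<ge> 8 / (3 * pi)"
    using C.expected_mean_singular_value_ge by simp
  then show "alpha_C d \<ge> 8 / (3 * pi) - 4 / real d"
    by (rule order_trans[rotated]) simp
  have "R.mean_singular_value = (\<lambda>G. sum_singular_values (real_matrix_of d G) / real d)"
    by (simp add: fun_eq_iff R.mean_singular_value_def R.ensemble_mat_def real_matrix_of_def)
  then have "alpha_R d = (\<integral>G. R.mean_singular_value G \<partial>R.ensemble)"
    by (simp add: alpha_R_def real_ginibre_def)
  \<comment> \<open>The only basis vector is 1, so the pseudo-variance is 1 and the dimension is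
    1.\<close>
  moreover have "R.pseudo_ratio = 1 / real d"
    by (simp add: R.pseudo_ratio_def R.pseudo_variance_def)
  ultimately have "alpha_R d \<ge> 8 / (3 * pi) - sqrt (1 / real d)"
    using R.expected_mean_singular_value_ge by simp
  moreover have "sqrt (1 / real d) \<ge> 0" "4 / real d \<ge> 0" by auto
  ultimately show "alpha_R d \<ge> 8 / (3 * pi) - 3 * sqrt (1 / real d) - 4 / real d"
    by linarith
qed

end
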